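(* Let $1<p<\infty$, $p-2<s<\infty$, $0\le\alpha<\frac{s-(p-2)}{p}$, and let $\varphi:\mathbb D\to\mathbb D$ be analytic. Let $C_\varphi f=f\circ\varphi$ be the composition operator with symbol $\varphi$. (i) If $s>p-1$, then $C_\varphi$ is bounded on $M_\alpha(D^p_s)$. (ii) If $\varphi$ is univalent and either ($2\le p<\infty$ and $p-2<s\le p-1$) or ($1<p<2$ and $0\le s\le p-1$), then $C_\varphi$ is bounded on $M_\alpha(D^p_s)$. Moreover, in these cases there is a constant $C>0$, depending only on $p,s,\alpha$ (not on $\varphi$), such that $$\|C_\varphi\|_{M_\alpha(D^p_s)}\le C\log\frac{e}{1-|\varphi(0)|}\ \text{ if }\alpha=0,\qquad \|C_\varphi\|_{M_\alpha(D^p_s)}\le C\left(\frac{1}{1-|\varphi(0)|}\right)^{\alpha}\ \text{ if }\alpha>0.$$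
   Context: $\mathbb D$ is the open unit disk of $\mathbb C$, $\mathcal H(\mathbb D)$ the space of analytic functions on $\mathbb D$, $dA$ Lebesgue area measure. A univalent function is an injective analytic function. For $1<p<\infty$ and $-1<s<\infty$, $D^p_s$ is the Banach space of $f\in\mathcal H(\mathbb D)$ with $\int_{\mathbb D}|f'(z)|^p(1-|z|^2)^s\,dA(z)<\infty$, normed by $\|f\|_{D^p_s}=|f(0)|+\left(\int_{\mathbb D}|f'(z)|^p(1-|z|^2)^s\,dA(z)\right)^{1/p}$. For $a\in\mathbb D$ put $\sigma_a(z)=\frac{a-z}{1-\overline a z}$. For $1<p<\infty$, $p-2\le s<\infty$, $0\le\alpha<\infty$, $M_\alpha(D^p_s)$ is the space of $f\in D^p_s$ with $\rho_{\alpha,p,s}(f)=\sup_{a\in\mathbb D}(1-|a|^2)^\alpha\|f\circ\sigma_a-f(a)\|_{D^p_s}<\infty$, normed by $\|f\|_{M_\alpha(D^p_s)}=|f(0)|+\rho_{\alpha,p,s}(f)$. $\|C_\varphi\|_{M_\alpha(D^p_s)}$ denotes the operator norm of $C_\varphi$ on $M_\alpha(D^p_s)$. *)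

theory Defs
  imports "HOL-Analysis.Analysis"
begin

text \<open>
  A function on the unit disc is represented by a total function of type
  \<open>complex \<Rightarrow> complex\<close>; its values outside the disc are irrelevant, since all definitions below
  only inspect it on \<open>unit_disc\<close>. Equality in the spaces is thus equality on \<open>unit_disc\<close>.
\<close>

abbreviation unit_disc :: "complex set"
  where "unit_disc \<equiv> ball 0 1"

definition D_density :: "real \<Rightarrow> real \<Rightarrow> (complex \<Rightarrow> complex) \<Rightarrow> complex \<Rightarrow> real"
  where "D_density p s f z = cmod (deriv f z) powr p * (1 - (cmod z)\<^sup>2) powr s"

definition D_space :: "real \<Rightarrow> real \<Rightarrow> (complex \<Rightarrow> complex) set"
  where "D_space p s =
    {f. f holomorphic_on unit_disc \<and> set_integrable lborel unit_disc (D_density p s f)}"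

definition D_norm :: "real \<Rightarrow> real \<Rightarrow> (complex \<Rightarrow> complex) \<Rightarrow> real"
  where "D_norm p s f =
    cmod (f 0) + (LINT z:unit_disc|lborel. D_density p s f z) powr (1 / p)"

definition disc_aut :: "complex \<Rightarrow> complex \<Rightarrow> complex"  (* sigma_a *)
  where "disc_aut a z = (a - z) / (1 - cnj a * z)"

definition disc_shift :: "complex \<Rightarrow> (complex \<Rightarrow> complex) \<Rightarrow> complex \<Rightarrow> complex"
  where "disc_shift a f z = f (disc_aut a z) - f a"

definition M_term :: "real \<Rightarrow> real \<Rightarrow> real \<Rightarrow> (complex \<Rightarrow> complex) \<Rightarrow> complex \<Rightarrow> real"
  where "M_term \<alpha> p s f a = (1 - (cmod a)\<^sup>2) powr \<alpha> * D_norm p s (disc_shift a f)"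

text \<open>
  Norms are real-valued, so finiteness of the supremum is split into two parts: each
  \<open>disc_shift a f\<close> has finite \<open>D_norm\<close> (lies in \<open>D_space\<close>), and the resulting real numbers are
  bounded above.
\<close>

definition M_space :: "real \<Rightarrow> real \<Rightarrow> real \<Rightarrow> (complex \<Rightarrow> complex) set"
  where "M_space \<alpha> p s =
    {f \<in> D_space p s. (\<forall>a\<in>unit_disc. disc_shift a f \<in> D_space p s) \<and>
       bdd_above (M_term \<alpha> p s f ` unit_disc)}"

definition M_rho :: "real \<Rightarrow> real \<Rightarrow> real \<Rightarrow> (complex \<Rightarrow> complex) \<Rightarrow> real"
  where "M_rho \<alpha> p s f = (SUP a\<in>unit_disc. M_term \<alpha> p s f a)"

definition M_norm :: "real \<Rightarrow> real \<Rightarrow> real \<Rightarrow> (complex \<Rightarrow> complex) \<Rightarrow> real"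
  where "M_norm \<alpha> p s f = cmod (f 0) + M_rho \<alpha> p s f"

definition comp_op :: "(complex \<Rightarrow> complex) \<Rightarrow> (complex \<Rightarrow> complex) \<Rightarrow> complex \<Rightarrow> complex"
  where "comp_op \<phi> f = f \<circ> \<phi>"

text \<open>Linearity is not part of the next definition: \<open>comp_op \<phi>\<close> is linear by construction.\<close>

definition M_bounded_op ::
    "real \<Rightarrow> real \<Rightarrow> real \<Rightarrow> ((complex \<Rightarrow> complex) \<Rightarrow> (complex \<Rightarrow> complex)) \<Rightarrow> bool"
  where "M_bounded_op \<alpha> p s T \<longleftrightarrow>
    T ` M_space \<alpha> p s \<subseteq> M_space \<alpha> p s \<and>
    (\<exists>K. \<forall>f\<in>M_space \<alpha> p s. M_norm \<alpha> p s (T f) \<le> K * M_norm \<alpha> p s f)"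

text \<open>A supremum of reals, meaningful when \<open>M_bounded_op\<close> holds.\<close>

definition M_op_norm ::
    "real \<Rightarrow> real \<Rightarrow> real \<Rightarrow> ((complex \<Rightarrow> complex) \<Rightarrow> (complex \<Rightarrow> complex)) \<Rightarrow> real"
  where "M_op_norm \<alpha> p s T =
    (SUP f\<in>{f \<in> M_space \<alpha> p s. M_norm \<alpha> p s f \<le> 1}. M_norm \<alpha> p s (T f))"

definition analytic_self_map :: "(complex \<Rightarrow> complex) \<Rightarrow> bool"
  where "analytic_self_map \<phi> \<longleftrightarrow> \<phi> holomorphic_on unit_disc \<and> \<phi> ` unit_disc \<subseteq> unit_disc"

definition univalent :: "(complex \<Rightarrow> complex) \<Rightarrow> bool"
  where "univalent \<phi> \<longleftrightarrow> \<phi> holomorphic_on unit_disc \<and> inj_on \<phi> unit_disc"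

definition admissible_univalent_params :: "real \<Rightarrow> real \<Rightarrow> bool"
  where "admissible_univalent_params p s \<longleftrightarrow>
    2 \<le> p \<and> p - 2 < s \<and> s \<le> p - 1 \<or> 1 < p \<and> p < 2 \<and> 0 \<le> s \<and> s \<le> p - 1"

end

(*
  Put b = phi(a), g = f o sigma_b - f(b) and psi = sigma_b o phi o sigma_a. Then psi(0) = 0 and
  f o phi o sigma_a - f(b) = g o psi, so it suffices to bound composition with psi on D^p_s uniformly
  over the self-maps psi fixing 0, and to estimate (1 - |a|^2) / (1 - |b|^2) <= 2 / (1 - |phi(0)|) by
  Schwarz-Pick; the remaining term |f(phi(0))| is controlled by integrating the resulting growth
  bound for f' along a radius.

  The uniform bound is a Carleson embedding: |g'|^p is dominated by its area means, so by Tonelli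
  one only needs that |psi'|^p (1 - |z|^2)^s dA gives mass O(d^(s+2)) to the preimage E of a disc of
  hyperbolically bounded size around zeta, d = 1 - |zeta|. On E one has 1 - |z|^2 <= 4d by Schwarz's
  lemma, and the Poisson kernel Re ((1 + cnj zeta psi) / (1 - cnj zeta psi)) is at least 1/(9d) there while
  its mean over every circle is 1; hence E meets each circle in a proportion O(d). For
  s > p - 1 this and Schwarz-Pick for psi' suffice; for univalent psi the integral of |psi'|^2 over E is
  an area, at most pi d^2, and the remaining power of psi' is absorbed by Schwarz-Pick (p >= 2) or by
  |psi'|^p <= 1 + |psi'|^2 (p < 2).
*)
theory Submission
  imports Defs "HOL-Complex_Analysis.Complex_Analysis"
begin

section \<open>Area and injective holomorphic maps\<close>

text \<open>The normalisation \<open>\<psi> 0 = 0\<close> makes Schwarz's lemma available with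
  constant 1, so \<open>\<phi> 0\<close> enters only through the comparison of the weights at a and
  b and through the growth of f along a radius. The logarithm arises from the growth alone: at
  \<alpha> = 0 the outer weights are 1, while the bound for f' by a multiple of 1 / (1 - r)
  integrates to a logarithm. The threshold p - 1 is an integrability threshold. Spending
  Schwarz-Pick on all p powers of psi' turns the weight exponent s into s - p, and (1 - |z|^2)^(s -
  p) is integrable near the circle only if s - p > -1. Below the threshold part of the derivative
  has to be kept, and injectivity is what bounds the integral of its square. In every case of the
  theorem s >= 0, which allows powers of comparable boundary distances to be compared monotonically.
  The estimates are carried out in \<open>ennreal\<close>, where Tonelli asks for no integrability;
  membership in \<open>D_space\<close> then follows from them.\<close>

definition vec_complex :: "real^2 \<Rightarrow> complex"
  where "vec_complex v = Complex (v $ 1) (v $ 2)"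

definition complex_vec :: "complex \<Rightarrow> real^2"
  where "complex_vec z = vector [Re z, Im z]"

lemma complex_vec_inverse [simp]: "vec_complex (complex_vec z) = z"
  by (simp add: vec_complex_def complex_vec_def)

lemma vec_complex_inverse [simp]: "complex_vec (vec_complex v) = v"
  by (simp add: vec_complex_def complex_vec_def vec_eq_iff forall_2)

lemma bounded_linear_vec_complex: "bounded_linear vec_complex"
  by (intro linear_conv_bounded_linear[THEN iffD1] linearI)
     (auto simp: vec_complex_def complex_eq_iff)

lemma bounded_linear_complex_vec: "bounded_linear complex_vec"
  by (intro linear_conv_bounded_linear[THEN iffD1] linearI)
     (auto simp: complex_vec_def vec_eq_iff forall_2)

lemma borel_measurable_vec_complex [measurable]: "vec_complex \<in> borel_measurable borel"
  by (intro borel_measurable_continuous_onI linear_continuous_on bounded_linear_vec_complex)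

text \<open>Lebesgue measure is determined by its values on boxes, and \<open>vec_complex\<close>
  pulls boxes back to boxes with the same side lengths. This carries the change of variables formula
  from \<open>real^2\<close>, where determinants live, to the complex plane.\<close>

lemma distr_lborel_vec_complex: "distr lborel borel vec_complex = lborel"
proof (rule sym, rule lborel_eqI)
  fix l u :: complex
  assume le: "\<And>b. b \<in> Basis \<Longrightarrow> l \<bullet> b \<le> u \<bullet> b"
  have le': "Re l \<le> Re u" "Im l \<le> Im u"
    using le[of 1] le[of \<i>] by (auto simp: Basis_complex_def)
  then have le_vec: "\<forall>i. complex_vec l $ i \<le> complex_vec u $ i"
    by (simp add: forall_2 complex_vec_def)
  have "vec_complex -` box l u = box (complex_vec l) (complex_vec u)"
    by (auto simp: box_def vec_complex_def complex_vec_def Basis_complex_def Basis_vec_def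
        inner_axis forall_2)
  hence "emeasure (distr lborel borel vec_complex) (box l u) =
      emeasure lborel (box (complex_vec l) (complex_vec u))"
    by (simp add: emeasure_distr)
  also have "\<dots> = ennreal (\<Prod>b\<in>Basis. (complex_vec u - complex_vec l) \<bullet> b)"
    using le_vec by (subst emeasure_lborel_box) (auto simp: Basis_vec_def inner_axis)
  also have "(\<Prod>b\<in>Basis. (complex_vec u - complex_vec l) \<bullet> b) =
      (\<Prod>i\<in>(UNIV::2 set). (complex_vec u - complex_vec l) $ i)"
  proof -
    have "(Basis :: (real^2) set) = (\<lambda>i. axis i 1) ` UNIV"
      by (auto simp: Basis_vec_def)
    then show ?thesis
      unfolding \<open>Basis = _\<close> by (subst prod.reindex) (auto simp: inj_on_def axis_eq_axis inner_axis)
  qed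
  also have "\<dots> = (\<Prod>b\<in>Basis. (u - l) \<bullet> b)"
    by (simp add: UNIV_2 complex_vec_def Basis_complex_def)
  finally show "emeasure (distr lborel borel vec_complex) (box l u) = ennreal (\<Prod>b\<in>Basis. (u - l) \<bullet> b)" .
qed simp

text \<open>The Cauchy-Riemann structure: multiplication by c is the real matrix with rows (Re c,
  -Im c) and (Im c, Re c).\<close>

lemma det_matrix_complex_mult:
  "det (matrix (\<lambda>v. complex_vec (c * vec_complex v))) = (cmod c)\<^sup>2"
  by (simp add: det_2 matrix_def complex_vec_def vec_complex_def axis_def cmod_power2)
     (simp add: power2_eq_square)

text \<open>Injectivity rules out multiplicity, so integrating the Jacobian gives exactly the area
  of the image. This serves both the rotation invariance of \<open>lborel\<close> and the mass
  estimate for univalent maps.\<close>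

theorem nn_integral_deriv_square_injective:
  assumes S: "open S" and hol: "f holomorphic_on S" and inj: "inj_on f S"
    and bdd: "bounded (f ` S)"
  shows "(\<integral>\<^sup>+z\<in>S. ennreal ((cmod (deriv f z))\<^sup>2) \<partial>lborel) = emeasure lborel (f ` S)"
proof -
  define S' where "S' = vec_complex -` S"
  define g where "g v = complex_vec (f (vec_complex v))" for v
  define g' where "g' v = (\<lambda>h. complex_vec (deriv f (vec_complex v) * vec_complex h))" for v
  have openS': "open S'"
    unfolding S'_def using S
    by (intro continuous_open_vimage) (auto intro: linear_continuous_at bounded_linear_vec_complex)
  have der: "(g has_derivative g' v) (at v within S')" if "v \<in> S'" for v
  proof -
    have "(f has_derivative (*) (deriv f (vec_complex v))) (at (vec_complex v))"
      using that S hol holomorphic_derivI[OF hol S, of "vec_complex v"]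
      by (auto simp: S'_def has_field_derivative_def)
    from diff_chain_at[OF bounded_linear_imp_has_derivative[OF bounded_linear_vec_complex] this]
    have "((\<lambda>x. f (vec_complex x)) has_derivative (\<lambda>h. deriv f (vec_complex v) * vec_complex h)) (at v)"
      by (simp add: o_def)
    from bounded_linear.has_derivative[OF bounded_linear_complex_vec this]
    show ?thesis unfolding g_def g'_def by (rule has_derivative_at_withinI)
  qed
  have injg: "inj_on g S'"
  proof (rule inj_onI)
    fix x y assume *: "x \<in> S'" "y \<in> S'" "g x = g y"
    then have "f (vec_complex x) = f (vec_complex y)"
      unfolding g_def by (metis complex_vec_inverse)
    then show "x = y"
      using * inj unfolding S'_def inj_on_def by (metis vec_complex_inverse vimageE)
  qed
  have img: "g ` S' = vec_complex -` (f ` S)"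
  proof (intro equalityI subsetI)
    fix v assume "v \<in> vec_complex -` (f ` S)"
    then obtain z where z: "z \<in> S" "vec_complex v = f z" by auto
    then have "v = g (complex_vec z)" unfolding g_def by (metis complex_vec_inverse vec_complex_inverse)
    then show "v \<in> g ` S'" using z by (auto simp: S'_def)
  qed (auto simp: g_def S'_def)
  have openfS: "open (f ` S)"
    using open_mapping_thm3[OF hol S inj] .
  have em: "emeasure lborel (g ` S') = emeasure lborel (f ` S)"
  proof -
    have "emeasure (distr lborel borel vec_complex) (f ` S) = emeasure lborel (g ` S')"
      unfolding img using openfS by (subst emeasure_distr) auto
    then show ?thesis by (simp add: distr_lborel_vec_complex)
  qed
  \<comment> \<open>\<open>has_measure_differentiable_image\<close> speaks of a real-valued measure;
    boundedness keeps the area of the image finite.\<close>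
  have fin: "emeasure lborel (f ` S) < \<infinity>"
    using bdd emeasure_bounded_finite by blast
  have opengS: "open (g ` S')"
    unfolding img using openfS
    by (intro continuous_open_vimage) (auto intro: linear_continuous_at bounded_linear_vec_complex)
  have lm: "g ` S' \<in> lmeasurable"
    using em fin opengS by (simp add: fmeasurable_def)
  have "((\<lambda>v. \<bar>det (matrix (g' v))\<bar>) has_integral measure lebesgue (g ` S')) S'"
    using has_measure_differentiable_image[OF _ der injg, of "measure lebesgue (g ` S')"] lm openS'
    by auto
  then have "((\<lambda>v. (cmod (deriv f (vec_complex v)))\<^sup>2) has_integral measure lebesgue (g ` S')) S'"
    by (simp add: g'_def det_matrix_complex_mult)
  then have "(\<integral>\<^sup>+v. indicator S' v * ennreal ((cmod (deriv f (vec_complex v)))\<^sup>2) \<partial>lborel) =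
      ennreal (measure lebesgue (g ` S'))"
    by (subst nn_integral_has_integral_lebesgue[symmetric])
       (auto intro!: nn_integral_cong simp: indicator_def)
  also have "\<dots> = emeasure lborel (f ` S)"
    using em fin opengS by (simp add: measure_def)
  finally have *: "(\<integral>\<^sup>+v. indicator S' v * ennreal ((cmod (deriv f (vec_complex v)))\<^sup>2) \<partial>lborel) =
      emeasure lborel (f ` S)" .
  have cont: "continuous_on S (\<lambda>z. (cmod (deriv f z))\<^sup>2)"
    using hol S by (intro continuous_intros holomorphic_on_imp_continuous_on holomorphic_deriv)
  have meas: "(\<lambda>z. indicator S z * ennreal ((cmod (deriv f z))\<^sup>2)) \<in> borel_measurable borel"
  proof -
    have "(\<lambda>z. indicator S z *\<^sub>R ((cmod (deriv f z))\<^sup>2)) \<in> borel_measurable borel"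
      using cont S by (intro borel_measurable_continuous_on_indicator) auto
    then have "(\<lambda>z. ennreal (indicator S z *\<^sub>R ((cmod (deriv f z))\<^sup>2))) \<in> borel_measurable borel"
      by measurable
    then show ?thesis
      by (rule measurable_cong[THEN iffD1, rotated]) (auto simp: indicator_def)
  qed
  have "(\<integral>\<^sup>+z. indicator S z * ennreal ((cmod (deriv f z))\<^sup>2) \<partial>distr lborel borel vec_complex) =
      emeasure lborel (f ` S)"
    using * meas by (subst nn_integral_distr) (auto simp: S'_def indicator_def)
  then show ?thesis by (simp add: distr_lborel_vec_complex mult.commute)
qed

section \<open>Rotation invariance of area\<close>

lemma distr_lborel_rotate:
  assumes c: "cmod c = 1"
  shows "distr lborel borel ((*) c) = lborel"
proof (rule sym, rule lborel_eqI)
  fix l u :: complex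
  assume le: "\<And>b. b \<in> Basis \<Longrightarrow> l \<bullet> b \<le> u \<bullet> b"
  have [simp]: "c \<noteq> 0" using c by auto
  \<comment> \<open>A rotated box need not be a box, so its measure cannot be read off; the area
    formula for z / c, whose derivative has modulus 1, computes it instead.\<close>
  have img: "(*) c -` box l u = (\<lambda>z. z / c) ` box l u"
    by (force simp: image_iff field_simps)
  have "emeasure (distr lborel borel ((*) c)) (box l u) = emeasure lborel ((\<lambda>z. z / c) ` box l u)"
    by (simp add: emeasure_distr img)
  also have "\<dots> = (\<integral>\<^sup>+z\<in>box l u. ennreal ((cmod (deriv (\<lambda>z. z / c) z))\<^sup>2) \<partial>lborel)"
    by (rule nn_integral_deriv_square_injective[symmetric])
       (auto intro!: holomorphic_intros bounded_linear_image[OF bounded_box] bounded_linear_divide inj_onI)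
  also have "\<dots> = (\<integral>\<^sup>+z\<in>box l u. 1 \<partial>lborel)"
  proof -
    have "deriv (\<lambda>z. z / c) z = 1 / c" for z
      by (rule DERIV_imp_deriv) (auto intro!: derivative_eq_intros)
    then show ?thesis by (simp add: norm_divide c)
  qed
  also have "\<dots> = emeasure lborel (box l u)" by simp
  also have "\<dots> = ennreal (\<Prod>b\<in>Basis. (u - l) \<bullet> b)"
    using le by (subst emeasure_lborel_box) auto
  finally show "emeasure (distr lborel borel ((*) c)) (box l u) = ennreal (\<Prod>b\<in>Basis. (u - l) \<bullet> b)" .
qed simp

lemma nn_integral_rotate:
  assumes "cmod c = 1" and [measurable]: "f \<in> borel_measurable borel"
  shows "(\<integral>\<^sup>+z. f (c * z) \<partial>lborel) = (\<integral>\<^sup>+z. f z \<partial>lborel)"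
  by (subst (2) distr_lborel_rotate[OF assms(1), symmetric]) (simp add: nn_integral_distr)

section \<open>Radial mean values\<close>

text \<open>Convexity, prepared for Jensen's inequality on a circle. The endpoint 0 is treated apart
  from the differentiable range; at m = 0 the left side vanishes because \<open>0 powr y = 0\<close>
  even for y = 0.\<close>

lemma powr_above_tangent:
  fixes x m p :: real
  assumes p: "1 \<le> p" and x: "0 \<le> x" and m: "0 \<le> m"
  shows "m powr p + p * m powr (p - 1) * (x - m) \<le> x powr p"
proof -
  consider "m = 0" | "m > 0" "x = 0" | "m > 0" "x > 0" using x m by fastforce
  then show ?thesis
  proof cases
    case 2
    then have "m powr (p - 1) * m = m powr p"
      by (simp add: powr_mult_base mult.commute)
    then have "m powr p + p * m powr (p - 1) * (x - m) = m powr p * (1 - p)"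
      using 2 by (simp add: algebra_simps)
    also have "\<dots> \<le> 0" using p by (intro mult_nonneg_nonpos) auto
    finally show ?thesis using 2 by simp
  next
    case 3
    have "p * m powr (p - 1) * (x - m) \<le> x powr p - m powr p"
      using 3 p by (intro convex_on_imp_above_tangent[OF powr_convex[OF p]])
        (auto simp: interior_open intro!: derivative_eq_intros)
    then show ?thesis by simp
  qed (use p in auto)
qed

lemma ball_in_borel [measurable]: "ball c r \<in> sets borel"
  by simp

text \<open>The angle is measured in turns, so integrals over \<open>{0..1}\<close> are already
  means over the circle, and the parametrisation is that of \<open>circlepath 0 1\<close>.\<close>

definition unit_rot :: "real \<Rightarrow> complex"
  where "unit_rot t = exp (2 * of_real pi * \<i> * of_real t)"

lemma norm_unit_rot [simp]: "cmod (unit_rot t) = 1"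
  by (simp add: unit_rot_def)

lemma continuous_on_unit_rot [continuous_intros]: "continuous_on A unit_rot"
  unfolding unit_rot_def by (intro continuous_intros)

lemma borel_measurable_unit_rot [measurable]: "unit_rot \<in> borel_measurable borel"
  by (intro borel_measurable_continuous_onI continuous_intros)

text \<open>Cauchy's formula is applied to u -> f (u z) on the unit circle. The circle through z is
  thus swept out by rotations of z, the form that rotation invariance of area produces.\<close>

lemma has_integral_circle_mean:
  assumes hol: "f holomorphic_on ball 0 R" and z: "cmod z < R"
  shows "((\<lambda>t. f (unit_rot t * z)) has_integral f 0) {0..1}"
proof -
  have "(\<lambda>u. f (u * z)) holomorphic_on cball 0 1"
  proof (rule holomorphic_on_compose_gen[of "\<lambda>u. u * z" _ f "ball 0 R", unfolded o_def])
    show "(\<lambda>u. u * z) ` cball 0 1 \<subseteq> ball 0 R"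
    proof clarify
      fix u :: complex assume "u \<in> cball 0 1"
      then have "cmod u * cmod z \<le> 1 * cmod z" by (intro mult_right_mono) auto
      then show "u * z \<in> ball 0 R" using z by (simp add: norm_mult)
    qed
  qed (auto intro!: holomorphic_intros hol)
  then have "((\<lambda>u. f (u * z) / (u - 0)) has_contour_integral (2 * of_real pi * \<i> * f (0 * z)))
      (circlepath 0 1)"
    by (rule Cauchy_integral_circlepath_simple) simp
  then have "((\<lambda>t. f (unit_rot t * z) / unit_rot t * (2 * pi * \<i> * unit_rot t))
      has_integral (2 * of_real pi * \<i> * f 0)) {0..1}"
    unfolding has_contour_integral vector_derivative_circlepath
    by (simp add: circlepath unit_rot_def)
  moreover have "unit_rot t \<noteq> 0" for t by (simp add: unit_rot_def)
  ultimately have "((\<lambda>t. (2 * of_real pi * \<i>) * f (unit_rot t * z))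
      has_integral (2 * of_real pi * \<i>) * f 0) {0..1}"
    by (simp add: mult_ac)
  from has_integral_mult_right[OF this, of "1 / (2 * of_real pi * \<i>)"]
  show ?thesis by simp
qed

text \<open>A substitute for polar coordinates: rotating by \<open>unit_rot t\<close> leaves the
  area integral unchanged, so one may average over t and exchange the integrals; the radial weight
  factors out of the angular mean.\<close>

lemma nn_integral_radial_average:
  fixes G :: "complex \<Rightarrow> real" and W :: "complex \<Rightarrow> ennreal"
  assumes cont: "continuous_on (ball 0 R) G"
    and W [measurable]: "W \<in> borel_measurable borel"
    and radial: "\<And>c z. cmod c = 1 \<Longrightarrow> W (c * z) = W z"
  shows "(\<integral>\<^sup>+z\<in>ball 0 R. ennreal (G z) * W z \<partial>lborel) =
    (\<integral>\<^sup>+z\<in>ball 0 R. (\<integral>\<^sup>+t\<in>{0..1}. ennreal (G (unit_rot t * z)) \<partial>lborel) * W z \<partial>lborel)"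
proof -
  \<comment> \<open>Extension by zero: G is arbitrary off the ball, and Tonelli needs a globally
    Borel function.\<close>
  define G0 where "G0 z = indicator (ball 0 R) z *\<^sub>R G z" for z
  have [measurable]: "G0 \<in> borel_measurable borel"
    unfolding G0_def using cont by (intro borel_measurable_continuous_on_indicator) auto
  have "(\<integral>\<^sup>+z\<in>ball 0 R. ennreal (G z) * W z \<partial>lborel) = (\<integral>\<^sup>+z. ennreal (G0 z) * W z \<partial>lborel)"
    by (intro nn_integral_cong) (auto simp: G0_def indicator_def)
  \<comment> \<open>The unit interval has mass one; this introduces the angle t before the
    rotation.\<close>
  also have "\<dots> = (\<integral>\<^sup>+t. (\<integral>\<^sup>+z. ennreal (G0 z) * W z \<partial>lborel) * indicator {0..1::real} t \<partial>lborel)"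
    by (simp add: nn_integral_cmult)
  also have "\<dots> = (\<integral>\<^sup>+t. (\<integral>\<^sup>+z. ennreal (G0 (unit_rot t * z)) * W z * indicator {0..1::real} t \<partial>lborel) \<partial>lborel)"
  proof (intro nn_integral_cong)
    fix t :: real
    have "(\<integral>\<^sup>+z. ennreal (G0 z) * W z \<partial>lborel) =
        (\<integral>\<^sup>+z. ennreal (G0 (unit_rot t * z)) * W (unit_rot t * z) \<partial>lborel)"
      by (rule nn_integral_rotate[symmetric]) auto
    then show "(\<integral>\<^sup>+z. ennreal (G0 z) * W z \<partial>lborel) * indicator {0..1::real} t =
        (\<integral>\<^sup>+z. ennreal (G0 (unit_rot t * z)) * W z * indicator {0..1::real} t \<partial>lborel)"
      by (subst nn_integral_multc) (auto simp: radial)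
  qed
  also have "\<dots> = (\<integral>\<^sup>+z. (\<integral>\<^sup>+t. ennreal (G0 (unit_rot t * z)) * W z * indicator {0..1::real} t \<partial>lborel) \<partial>lborel)"
    by (rule lborel_pair.Fubini') simp
  also have "\<dots> = (\<integral>\<^sup>+z\<in>ball 0 R. (\<integral>\<^sup>+t\<in>{0..1}. ennreal (G (unit_rot t * z)) \<partial>lborel) * W z \<partial>lborel)"
  proof (intro nn_integral_cong)
    fix z :: complex
    have "(\<integral>\<^sup>+t. ennreal (G0 (unit_rot t * z)) * W z * indicator {0..1::real} t \<partial>lborel) =
       (\<integral>\<^sup>+t. ennreal (G0 (unit_rot t * z)) * indicator {0..1::real} t \<partial>lborel) * W z"
      by (subst nn_integral_multc[symmetric]) (auto simp: mult_ac)
    also have "\<dots> = (\<integral>\<^sup>+t\<in>{0..1}. ennreal (G (unit_rot t * z)) \<partial>lborel) * W z * indicator (ball 0 R) z"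
      by (cases "cmod z < R") (simp_all add: G0_def norm_mult)
    finally show "(\<integral>\<^sup>+t. ennreal (G0 (unit_rot t * z)) * W z * indicator {0..1::real} t \<partial>lborel) =
      (\<integral>\<^sup>+t\<in>{0..1}. ennreal (G (unit_rot t * z)) \<partial>lborel) * W z * indicator (ball 0 R) z" .
  qed
  finally show ?thesis .
qed

text \<open>The mean value property of the harmonic function Re f on all circles at once. The sign
  condition matters because \<open>ennreal\<close> sends negative reals to 0, which would spoil
  cancellation in the mean.\<close>

lemma nn_integral_Re_radial:
  fixes W :: "complex \<Rightarrow> ennreal"
  assumes hol: "f holomorphic_on ball 0 R"
    and nonneg: "\<And>z. cmod z < R \<Longrightarrow> 0 \<le> Re (f z)"
    and W [measurable]: "W \<in> borel_measurable borel"
    and radial: "\<And>c z. cmod c = 1 \<Longrightarrow> W (c * z) = W z"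
  shows "(\<integral>\<^sup>+z\<in>ball 0 R. ennreal (Re (f z)) * W z \<partial>lborel) =
    ennreal (Re (f 0)) * (\<integral>\<^sup>+z\<in>ball 0 R. W z \<partial>lborel)"
proof -
  have "(\<integral>\<^sup>+z\<in>ball 0 R. ennreal (Re (f z)) * W z \<partial>lborel) =
    (\<integral>\<^sup>+z\<in>ball 0 R. (\<integral>\<^sup>+t\<in>{0..1}. ennreal (Re (f (unit_rot t * z))) \<partial>lborel) * W z \<partial>lborel)"
    using hol by (intro nn_integral_radial_average)
      (auto intro!: continuous_intros holomorphic_on_imp_continuous_on radial)
  also have "\<dots> = (\<integral>\<^sup>+z\<in>ball 0 R. ennreal (Re (f 0)) * W z \<partial>lborel)"
  proof (intro nn_integral_cong)
    fix z :: complex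
    have "(\<integral>\<^sup>+t\<in>{0..1}. ennreal (Re (f (unit_rot t * z))) \<partial>lborel) = ennreal (Re (f 0))"
      if "cmod z < R"
    proof -
      have "((\<lambda>t. Re (f (unit_rot t * z))) has_integral Re (f 0)) {0..1}"
        using has_integral_linear[OF has_integral_circle_mean[OF hol that] bounded_linear_Re]
        by (simp add: o_def)
      then have "(\<integral>\<^sup>+t. ennreal (indicator {0..1} t * Re (f (unit_rot t * z))) \<partial>lborel) = ennreal (Re (f 0))"
        using nonneg that by (intro nn_integral_has_integral_lebesgue) (auto simp: norm_mult)
      then show ?thesis by (simp add: ennreal_mult' ennreal_indicator mult.commute)
    qed
    then show "(\<integral>\<^sup>+t\<in>{0..1}. ennreal (Re (f (unit_rot t * z))) \<partial>lborel) * W z * indicator (ball 0 R) z =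
      ennreal (Re (f 0)) * W z * indicator (ball 0 R) z"
      by (auto simp: indicator_def)
  qed
  also have "\<dots> = ennreal (Re (f 0)) * (\<integral>\<^sup>+z\<in>ball 0 R. W z \<partial>lborel)"
    by (subst nn_integral_cmult[symmetric]) (auto simp: mult_ac)
  finally show ?thesis .
qed

text \<open>Jensen's inequality: integrate the tangent inequality at m = |f 0|. Its linear term has
  mean J - m, which is nonnegative because f 0 is the mean of f.\<close>

lemma circle_mean_powr:
  assumes hol: "f holomorphic_on ball 0 R" and z: "cmod z < R" and p: "1 \<le> p"
  shows "ennreal (cmod (f 0) powr p) \<le> (\<integral>\<^sup>+t\<in>{0..1}. ennreal (cmod (f (unit_rot t * z)) powr p) \<partial>lborel)"
proof -
  define m where "m = cmod (f 0)"
  have cont: "continuous_on {0..1} (\<lambda>t. f (unit_rot t * z))"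
    by (rule continuous_on_compose2[OF holomorphic_on_imp_continuous_on[OF hol]])
       (use z in \<open>auto intro!: continuous_intros simp: norm_mult\<close>)
  have contp: "continuous_on {0..1} (\<lambda>t. cmod (f (unit_rot t * z)) powr p)"
    using cont p by (intro continuous_on_powr' continuous_intros) auto
  define J where "J = integral {0..1} (\<lambda>t. cmod (f (unit_rot t * z)))"
  define I where "I = integral {0..1} (\<lambda>t. cmod (f (unit_rot t * z)) powr p)"
  have J: "((\<lambda>t. cmod (f (unit_rot t * z))) has_integral J) {0..1}"
    unfolding J_def using cont by (intro integrable_integral integrable_continuous_interval continuous_intros)
  have I: "((\<lambda>t. cmod (f (unit_rot t * z)) powr p) has_integral I) {0..1}"
    unfolding I_def using contp by (intro integrable_integral integrable_continuous_interval)
  have mJ: "m \<le> J"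
    using integral_norm_bound_integral[OF has_integral_integrable[OF has_integral_circle_mean[OF hol z]]
        has_integral_integrable[OF J]]
    unfolding m_def J_def integral_unique[OF has_integral_circle_mean[OF hol z]] by simp
  have const: "((\<lambda>t. x) has_integral x) {0..1::real}" for x :: real
    using has_integral_const_real[of x 0 1] by simp
  have "((\<lambda>t. m powr p + p * m powr (p - 1) * (cmod (f (unit_rot t * z)) - m)) has_integral
      (m powr p + p * m powr (p - 1) * (J - m))) {0..1}"
    by (rule has_integral_add[OF const has_integral_mult_right[OF has_integral_diff[OF J const]]])
  then have "m powr p + p * m powr (p - 1) * (J - m) \<le> I"
    by (rule has_integral_le[OF _ I]) (auto intro!: powr_above_tangent p simp: m_def)
  moreover have "0 \<le> p * m powr (p - 1) * (J - m)"
    using mJ p by auto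
  ultimately have "m powr p \<le> I" by linarith
  moreover have "(\<integral>\<^sup>+t. ennreal (indicator {0..1} t * (cmod (f (unit_rot t * z)) powr p)) \<partial>lborel) = ennreal I"
    by (intro nn_integral_has_integral_lebesgue I) auto
  ultimately show ?thesis
    by (simp add: m_def ennreal_mult' ennreal_indicator mult.commute ennreal_leI)
qed

text \<open>Subharmonicity of |f|^p, with a free radial weight because two are used: the constant 1
  on small discs and (1 - |z|^2)^s on the whole disc.\<close>

lemma powr_radial_mean:
  fixes W :: "complex \<Rightarrow> ennreal"
  assumes hol: "f holomorphic_on ball 0 R" and p: "1 \<le> p"
    and W [measurable]: "W \<in> borel_measurable borel"
    and radial: "\<And>c z. cmod c = 1 \<Longrightarrow> W (c * z) = W z"
  shows "ennreal (cmod (f 0) powr p) * (\<integral>\<^sup>+z\<in>ball 0 R. W z \<partial>lborel) \<le>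
    (\<integral>\<^sup>+z\<in>ball 0 R. ennreal (cmod (f z) powr p) * W z \<partial>lborel)"
proof -
  have "ennreal (cmod (f 0) powr p) * (\<integral>\<^sup>+z\<in>ball 0 R. W z \<partial>lborel) =
      (\<integral>\<^sup>+z\<in>ball 0 R. ennreal (cmod (f 0) powr p) * W z \<partial>lborel)"
    by (subst nn_integral_cmult[symmetric]) (auto simp: mult_ac)
  also have "\<dots> \<le> (\<integral>\<^sup>+z\<in>ball 0 R. (\<integral>\<^sup>+t\<in>{0..1}. ennreal (cmod (f (unit_rot t * z)) powr p) \<partial>lborel) * W z \<partial>lborel)"
    by (intro nn_integral_mono)
       (auto split: split_indicator intro!: mult_right_mono circle_mean_powr[OF hol _ p])
  also have "\<dots> = (\<integral>\<^sup>+z\<in>ball 0 R. ennreal (cmod (f z) powr p) * W z \<partial>lborel)"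
    using p by (intro nn_integral_radial_average[symmetric] radial W continuous_on_powr'
        continuous_on_norm continuous_on_const holomorphic_on_imp_continuous_on[OF hol]) auto
  finally show ?thesis .
qed

section \<open>Disc automorphisms and the Schwarz--Pick lemma\<close>

lemma nn_integral_disc_norm_square:
  fixes f :: "real \<Rightarrow> ennreal"
  assumes [measurable]: "f \<in> borel_measurable borel"
  shows "(\<integral>\<^sup>+z\<in>ball (0::complex) 1. f ((cmod z)\<^sup>2) \<partial>lborel) = ennreal pi * (\<integral>\<^sup>+x\<in>{0..<1}. f x \<partial>lborel)"
proof -
  \<comment> \<open>Under area on the disc, |z|^2 is uniformly distributed on [0, 1) with total mass
    pi, since the ring |z|^2 > x has area pi (1 - x). M is the image measure and N its claimed
    value; they are compared on the rays \<open>{x<..}\<close>.\<close>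
  define M where "M = distr (density lborel (indicator (ball (0::complex) 1))) borel (\<lambda>z. (cmod z)\<^sup>2)"
  define N where "N = density lborel (\<lambda>x::real. ennreal pi * indicator {0..<1} x)"
  have vol: "emeasure lborel (ball (0::complex) r) = ennreal (pi * r\<^sup>2)" if "r \<ge> 0" for r
    using that by (simp add: emeasure_ball unit_ball_vol_2 ennreal_mult)
  have cvol: "emeasure lborel (cball (0::complex) r) = ennreal (pi * r\<^sup>2)" if "r \<ge> 0" for r
    using that by (simp add: emeasure_cball unit_ball_vol_2 ennreal_mult)
  have M: "emeasure M {x<..} = emeasure lborel (ball (0::complex) 1 \<inter> {z. x < (cmod z)\<^sup>2})" for x
  proof -
    have "emeasure M {x<..} = emeasure (density lborel (indicator (ball (0::complex) 1))) {z. x < (cmod z)\<^sup>2}"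
      unfolding M_def by (subst emeasure_distr) (auto simp: vimage_def)
    also have "\<dots> = (\<integral>\<^sup>+z. indicator (ball (0::complex) 1) z * indicator {z. x < (cmod z)\<^sup>2} z \<partial>lborel)"
      by (subst emeasure_density) auto
    also have "\<dots> = (\<integral>\<^sup>+z. indicator (ball (0::complex) 1 \<inter> {z. x < (cmod z)\<^sup>2}) z \<partial>lborel)"
      by (intro nn_integral_cong) (auto split: split_indicator)
    also have "\<dots> = emeasure lborel (ball (0::complex) 1 \<inter> {z. x < (cmod z)\<^sup>2})"
      by (rule nn_integral_indicator) measurable
    finally show ?thesis .
  qed
  have N: "emeasure N {x<..} = ennreal pi * emeasure lborel ({0..<1} \<inter> {x<..})" for x
  proof -
    have "emeasure N {x<..} = (\<integral>\<^sup>+y. ennreal pi * indicator {0..<1} y * indicator {x<..} y \<partial>lborel)"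
      unfolding N_def by (subst emeasure_density) auto
    also have "\<dots> = (\<integral>\<^sup>+y. ennreal pi * indicator ({0..<1} \<inter> {x<..}) y \<partial>lborel)"
      by (intro nn_integral_cong) (auto split: split_indicator)
    also have "\<dots> = ennreal pi * emeasure lborel ({0..<1} \<inter> {x<..})"
      by (subst nn_integral_cmult) auto
    finally show ?thesis .
  qed
  \<comment> \<open>Clamping x to [0, 1] gives one formula for all rays, including those that
    contain the interval or miss it.\<close>
  have MN: "emeasure M {x<..} = ennreal (pi * (1 - max 0 (min 1 x)))"
    "emeasure N {x<..} = ennreal (pi * (1 - max 0 (min 1 x)))" for x
  proof -
    consider "x < 0" | "0 \<le> x" "x < 1" | "1 \<le> x" by linarith
    then have "emeasure M {x<..} = ennreal (pi * (1 - max 0 (min 1 x))) \<and>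
      emeasure N {x<..} = ennreal (pi * (1 - max 0 (min 1 x)))"
    proof cases
      case 1
      have "ball (0::complex) 1 \<inter> {z. x < (cmod z)\<^sup>2} = ball 0 1"
        using 1 by (auto intro: less_le_trans)
      moreover have "{0..<1} \<inter> {x<..} = {0..<1}" using 1 by auto
      ultimately show ?thesis using 1 by (simp add: M N vol)
    next
      case 2
      then have "sqrt x < 1" by simp
      have lt_iff: "x < (cmod z)\<^sup>2 \<longleftrightarrow> sqrt x < cmod z" for z
        using real_sqrt_less_iff[of x "(cmod z)\<^sup>2"] by simp
      have "ball (0::complex) 1 \<inter> {z. x < (cmod z)\<^sup>2} = ball 0 1 - cball 0 (sqrt x)"
        by (rule set_eqI) (simp add: lt_iff not_le)
      moreover have "emeasure lborel (ball (0::complex) 1 - cball 0 (sqrt x)) =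
          emeasure lborel (ball (0::complex) 1) - emeasure lborel (cball (0::complex) (sqrt x))"
        using 2 by (intro emeasure_Diff) (auto simp: cvol intro: le_less_trans[OF _ \<open>sqrt x < 1\<close>])
      moreover have "{0..<1} \<inter> {x<..} = {x<..<1}" using 2 by auto
      moreover have "ennreal pi - ennreal pi * ennreal x = ennreal (pi - pi * x)"
        using 2 by (simp add: ennreal_minus flip: ennreal_mult')
      ultimately have "emeasure M {x<..} = ennreal (pi - pi * x)"
        "emeasure N {x<..} = ennreal (pi * (1 - x))"
        using 2 vol[of 1] cvol[of "sqrt x"] by (simp_all add: M N ennreal_minus ennreal_mult')
      then show ?thesis using 2 by (simp add: right_diff_distrib)
    next
      case 3
      have "ball (0::complex) 1 \<inter> {z. x < (cmod z)\<^sup>2} = {}"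
      proof -
        have "(cmod z)\<^sup>2 \<le> 1" if "cmod z < 1" for z
          using that by (intro power_le_one) auto
        then show ?thesis using 3 by force
      qed
      moreover have "{0..<1} \<inter> {x<..} = {}" using 3 by auto
      ultimately show ?thesis using 3 by (simp add: M N)
    qed
    then show "emeasure M {x<..} = ennreal (pi * (1 - max 0 (min 1 x)))"
      "emeasure N {x<..} = ennreal (pi * (1 - max 0 (min 1 x)))" by auto
  qed
  have "M = N"
    by (rule measure_eqI_lessThan) (simp_all add: MN, simp_all add: M_def N_def)
  have "(\<integral>\<^sup>+z\<in>ball (0::complex) 1. f ((cmod z)\<^sup>2) \<partial>lborel) = integral\<^sup>N M f"
    unfolding M_def by (simp add: nn_integral_distr nn_integral_density mult.commute)
  also have "\<dots> = (\<integral>\<^sup>+x. ennreal pi * (f x * indicator {0..<1} x) \<partial>lborel)"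
    unfolding \<open>M = N\<close> N_def by (simp add: nn_integral_density mult_ac)
  also have "\<dots> = ennreal pi * (\<integral>\<^sup>+x\<in>{0..<1}. f x \<partial>lborel)"
    by (rule nn_integral_cmult) simp
  finally show ?thesis .
qed

text \<open>In the variable x = 1 - |z|^2 the annulus becomes an interval ending at 0, and \<gamma>
  > -1 is the integrability of x^\<gamma> there.\<close>

lemma nn_integral_boundary_annulus:
  fixes \<gamma> \<delta> :: real
  assumes \<gamma>: "-1 < \<gamma>" and \<delta>: "0 \<le> \<delta>"
  shows "(\<integral>\<^sup>+z\<in>unit_disc. ennreal ((1 - (cmod z)\<^sup>2) powr \<gamma>) * indicator {..\<delta>} (1 - (cmod z)\<^sup>2) \<partial>lborel)
    \<le> ennreal (pi * \<delta> powr (\<gamma> + 1) / (\<gamma> + 1))"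
proof -
  define f where "f x = ennreal ((1 - x) powr \<gamma>) * indicator {..\<delta>} (1 - x)" for x :: real
  have [measurable]: "f \<in> borel_measurable borel" unfolding f_def by measurable
  have "(\<integral>\<^sup>+x\<in>{0..<1}. f x \<partial>lborel) \<le> (\<integral>\<^sup>+x. ennreal (indicator {0..\<delta>} (1 - x) * (1 - x) powr \<gamma>) \<partial>lborel)"
    by (intro nn_integral_mono) (auto simp: f_def split: split_indicator)
  also have "\<dots> = (\<integral>\<^sup>+x. ennreal (indicator {0..\<delta>} x * x powr \<gamma>) \<partial>lborel)"
    using nn_integral_real_affine[of "\<lambda>x. ennreal (indicator {0..\<delta>} x * x powr \<gamma>)" "-1" 1] by simp
  also have "\<dots> = ennreal (\<delta> powr (\<gamma> + 1) / (\<gamma> + 1))"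
    using has_integral_powr_from_0[OF \<gamma> \<delta>] by (intro nn_integral_has_integral_lebesgue) auto
  finally have le: "(\<integral>\<^sup>+x\<in>{0..<1}. f x \<partial>lborel) \<le> ennreal (\<delta> powr (\<gamma> + 1) / (\<gamma> + 1))" .
  have "(\<integral>\<^sup>+z\<in>unit_disc. f ((cmod z)\<^sup>2) \<partial>lborel) = ennreal pi * (\<integral>\<^sup>+x\<in>{0..<1}. f x \<partial>lborel)"
    by (rule nn_integral_disc_norm_square) simp
  also have "\<dots> \<le> ennreal pi * ennreal (\<delta> powr (\<gamma> + 1) / (\<gamma> + 1))"
    by (intro mult_left_mono le) simp
  also have "\<dots> = ennreal (pi * \<delta> powr (\<gamma> + 1) / (\<gamma> + 1))"
    by (simp flip: ennreal_mult')
  finally show ?thesis by (simp add: f_def)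
qed

section \<open>Disc automorphisms\<close>

lemma norm_square_less_one: "cmod z < 1 \<Longrightarrow> (cmod z)\<^sup>2 < 1"
  by (simp add: power_less_one_iff)

lemma disc_aut_denominator_nonzero:
  assumes "cmod a < 1" "cmod z < 1"
  shows "1 - cnj a * z \<noteq> 0"
proof
  assume "1 - cnj a * z = 0"
  then have "cmod (cnj a * z) = 1" by (metis eq_iff_diff_eq_0 norm_one)
  moreover have "cmod a * cmod z < 1 * 1" using assms by (intro mult_strict_mono) auto
  ultimately show False by (simp add: norm_mult)
qed

text \<open>The product of the two defects is the difference between the squared moduli of
  denominator and numerator. This gives both that automorphisms preserve the disc and how they
  change the distance to the circle.\<close>

lemma one_minus_norm_disc_aut:
  assumes "cmod a < 1" "cmod z < 1"
  shows "1 - (cmod (disc_aut a z))\<^sup>2 = (1 - (cmod a)\<^sup>2) * (1 - (cmod z)\<^sup>2) / (cmod (1 - cnj a * z))\<^sup>2"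
proof -
  have "(cmod (1 - cnj a * z))\<^sup>2 - (cmod (a - z))\<^sup>2 = (1 - (cmod a)\<^sup>2) * (1 - (cmod z)\<^sup>2)"
    by (simp only: cmod_power2) (simp add: power2_eq_square algebra_simps)
  then show ?thesis
    using disc_aut_denominator_nonzero[OF assms]
    by (simp add: disc_aut_def norm_divide power_divide field_simps)
qed

lemma norm_disc_aut_less:
  assumes "cmod a < 1" "cmod z < 1"
  shows "cmod (disc_aut a z) < 1"
proof -
  have "0 < 1 - (cmod (disc_aut a z))\<^sup>2"
    unfolding one_minus_norm_disc_aut[OF assms]
    using disc_aut_denominator_nonzero[OF assms] norm_square_less_one assms by simp
  then show ?thesis by (simp add: power_less_one_iff)
qed

lemma disc_aut_involution:
  assumes "cmod a < 1" "cmod z < 1"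
  shows "disc_aut a (disc_aut a z) = z"
proof -
  define d where "d = 1 - cnj a * z"
  have d: "d \<noteq> 0" using disc_aut_denominator_nonzero[OF assms] by (simp add: d_def)
  have e: "1 - cnj a * a \<noteq> 0" using disc_aut_denominator_nonzero[OF assms(1) assms(1)] .
  have n: "a - disc_aut a z = z * (1 - cnj a * a) / d"
    using d by (simp add: disc_aut_def flip: d_def) (simp add: field_simps d_def)
  have m: "1 - cnj a * disc_aut a z = (1 - cnj a * a) / d"
    using d by (simp add: disc_aut_def flip: d_def) (simp add: field_simps d_def)
  show ?thesis
    unfolding disc_aut_def[of a "disc_aut a z"] n m using d e by simp
qed

lemma disc_aut_0 [simp]: "disc_aut a 0 = a"
  by (simp add: disc_aut_def)

lemma disc_aut_self [simp]: "disc_aut a a = 0"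
  by (simp add: disc_aut_def)

lemma holomorphic_on_disc_aut:
  assumes "cmod a < 1"
  shows "disc_aut a holomorphic_on unit_disc"
  unfolding disc_aut_def
  using disc_aut_denominator_nonzero[OF assms] by (intro holomorphic_intros) auto

lemma has_field_derivative_disc_aut_0:
  "(disc_aut a has_field_derivative - of_real (1 - (cmod a)\<^sup>2)) (at 0)"
proof -
  have "(disc_aut a has_field_derivative (- 1 * (1 - cnj a * 0) - (a - 0) * - cnj a) / (1 - cnj a * 0)\<^sup>2) (at 0)"
    unfolding disc_aut_def by (auto intro!: derivative_eq_intros simp: power2_eq_square)
  then show ?thesis by (simp flip: complex_norm_square add: mult.commute)
qed

lemma inj_on_disc_aut:
  assumes "cmod a < 1"
  shows "inj_on (disc_aut a) unit_disc"
  by (rule inj_on_inverseI[of _ "disc_aut a"]) (simp add: disc_aut_involution assms)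

section \<open>Self-maps of the disc and the Schwarz-Pick lemma\<close>

lemma analytic_self_map_disc_aut: "cmod a < 1 \<Longrightarrow> analytic_self_map (disc_aut a)"
  using holomorphic_on_disc_aut norm_disc_aut_less by (auto simp: analytic_self_map_def)

lemma analytic_self_map_compose:
  assumes "analytic_self_map f" "analytic_self_map g"
  shows "analytic_self_map (\<lambda>z. f (g z))"
  using assms holomorphic_on_compose_gen[of g unit_disc f unit_disc]
  by (auto simp: analytic_self_map_def o_def)

lemma analytic_self_map_norm: "analytic_self_map f \<Longrightarrow> cmod z < 1 \<Longrightarrow> cmod (f z) < 1"
  by (simp add: analytic_self_map_def image_subset_iff)

lemma analytic_self_map_holomorphic: "analytic_self_map f \<Longrightarrow> f holomorphic_on unit_disc"
  by (auto simp: analytic_self_map_def)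

lemma Schwarz_Pick_deriv:
  assumes f: "analytic_self_map f" and z: "cmod z < 1"
  shows "cmod (deriv f z) * (1 - (cmod z)\<^sup>2) \<le> 1 - (cmod (f z))\<^sup>2"
proof -
  define h where "h w = disc_aut (f z) (f (disc_aut z w))" for w
  have fz: "cmod (f z) < 1" using analytic_self_map_norm[OF f z] .
  have h: "analytic_self_map h"
    unfolding h_def
    by (rule analytic_self_map_compose[OF analytic_self_map_disc_aut[OF fz]
          analytic_self_map_compose[OF f analytic_self_map_disc_aut[OF z]]])
  have h0: "h 0 = 0" by (simp add: h_def)
  have le: "cmod (deriv h 0) \<le> 1"
  proof (rule Schwarz_Lemma(2)[where f = h and \<xi> = 0])
    show "cmod (h w) < 1" if "cmod w < 1" for w
      using analytic_self_map_norm[OF h that] .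
  qed (use analytic_self_map_holomorphic[OF h] h0 in simp_all)
  \<comment> \<open>In this form, with \<open>h 0 = 0\<close>, both automorphisms are differentiated
    at 0 only, where their derivatives are real; differentiating the two sides then compares f' with
    \<open>deriv h 0\<close>.\<close>
  have eq: "f (disc_aut z w) = disc_aut (f z) (h w)" if "w \<in> unit_disc" for w
    using that disc_aut_involution[OF fz analytic_self_map_norm[OF f norm_disc_aut_less[OF z]], of w]
    by (simp add: h_def)
  have "(f has_field_derivative deriv f z) (at (disc_aut z 0))"
    using holomorphic_derivI[OF analytic_self_map_holomorphic[OF f] open_ball, of z] z by simp
  then have 1: "((\<lambda>w. f (disc_aut z w)) has_field_derivative deriv f z * - of_real (1 - (cmod z)\<^sup>2)) (at 0)"
    using DERIV_chain2[OF _ has_field_derivative_disc_aut_0] by blast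
  have "(h has_field_derivative deriv h 0) (at 0)"
    using holomorphic_derivI[OF analytic_self_map_holomorphic[OF h] open_ball, of 0] by simp
  then have "((\<lambda>w. disc_aut (f z) (h w)) has_field_derivative - of_real (1 - (cmod (f z))\<^sup>2) * deriv h 0) (at 0)"
    using DERIV_chain2[of "disc_aut (f z)" "- of_real (1 - (cmod (f z))\<^sup>2)" h 0 "deriv h 0" UNIV] has_field_derivative_disc_aut_0
    by (simp add: h0)
  then have "((\<lambda>w. f (disc_aut z w)) has_field_derivative - of_real (1 - (cmod (f z))\<^sup>2) * deriv h 0) (at 0)"
    by (rule has_field_derivative_transform_within_open[of _ _ _ unit_disc]) (auto simp: eq)
  with 1 have "deriv f z * - of_real (1 - (cmod z)\<^sup>2) = - of_real (1 - (cmod (f z))\<^sup>2) * deriv h 0"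
    by (rule DERIV_unique)
  then have "cmod (deriv f z * - of_real (1 - (cmod z)\<^sup>2)) = cmod (- of_real (1 - (cmod (f z))\<^sup>2) * deriv h 0)"
    by simp
  then have "cmod (deriv f z) * (1 - (cmod z)\<^sup>2) = (1 - (cmod (f z))\<^sup>2) * cmod (deriv h 0)"
    using norm_square_less_one[OF z] norm_square_less_one[OF fz]
    by (simp only: norm_mult norm_minus_cancel norm_of_real abs_of_pos diff_gt_0_iff_gt mult.commute)
  also have "\<dots> \<le> (1 - (cmod (f z))\<^sup>2) * 1"
    using norm_square_less_one[OF fz] le by (intro mult_left_mono) auto
  finally show ?thesis by simp
qed

text \<open>Schwarz's lemma for the map sigma_c o f, where c = f 0, read through the formula for 1 -
  |sigma_c w|^2. Its power \<alpha> converts the weight at a into the weight at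
  \<open>\<phi> a\<close>.\<close>

lemma Schwarz_Pick_boundary:
  assumes f: "analytic_self_map f" and z: "cmod z < 1"
  shows "1 - (cmod z)\<^sup>2 \<le> 2 / (1 - cmod (f 0)) * (1 - (cmod (f z))\<^sup>2)"
proof -
  define c where "c = f 0"
  have c: "cmod c < 1" using analytic_self_map_norm[OF f, of 0] by (simp add: c_def)
  have fz: "cmod (f z) < 1" using analytic_self_map_norm[OF f z] .
  define h where "h w = disc_aut c (f w)" for w
  have h: "analytic_self_map h"
    unfolding h_def by (rule analytic_self_map_compose[OF analytic_self_map_disc_aut[OF c] f])
  have h0: "h 0 = 0" by (simp add: h_def c_def)
  have "cmod (h z) \<le> cmod z"
  proof (rule Schwarz_Lemma(1)[where f = h and \<xi> = z])
    show "cmod (h w) < 1" if "cmod w < 1" for w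
      using analytic_self_map_norm[OF h that] .
  qed (use analytic_self_map_holomorphic[OF h] h0 z in simp_all)
  then have "1 - (cmod z)\<^sup>2 \<le> 1 - (cmod (disc_aut c (f z)))\<^sup>2"
    unfolding h_def by (simp add: power_mono)
  also have "\<dots> = (1 - (cmod c)\<^sup>2) / (cmod (1 - cnj c * f z))\<^sup>2 * (1 - (cmod (f z))\<^sup>2)"
    unfolding one_minus_norm_disc_aut[OF c fz] by simp
  also have "\<dots> \<le> 2 / (1 - cmod c) * (1 - (cmod (f z))\<^sup>2)"
  proof (rule mult_right_mono)
    have "cmod c * cmod (f z) \<le> cmod c * 1" using fz by (intro mult_left_mono) auto
    then have "1 - cmod c \<le> 1 - cmod (cnj c * f z)" by (simp add: norm_mult)
    also have "\<dots> \<le> cmod (1 - cnj c * f z)" by (metis norm_one norm_triangle_ineq2)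
    finally have le: "1 - cmod c \<le> cmod (1 - cnj c * f z)" .
    then have "(1 - cmod c)\<^sup>2 \<le> (cmod (1 - cnj c * f z))\<^sup>2" using c by (intro power_mono) auto
    then have "(1 - (cmod c)\<^sup>2) / (cmod (1 - cnj c * f z))\<^sup>2 \<le> (1 - (cmod c)\<^sup>2) / (1 - cmod c)\<^sup>2"
      using c norm_square_less_one[OF c] le
      by (intro divide_left_mono mult_pos_pos zero_less_power) auto
    also have "\<dots> = (1 + cmod c) / (1 - cmod c)"
      using c by (simp add: power2_eq_square square_diff_one_factored[symmetric] divide_simps) (simp add: algebra_simps)
    also have "\<dots> \<le> 2 / (1 - cmod c)" using c by (intro divide_right_mono) auto
    finally show "(1 - (cmod c)\<^sup>2) / (cmod (1 - cnj c * f z))\<^sup>2 \<le> 2 / (1 - cmod c)" .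
  qed (use norm_square_less_one[OF fz] in auto)
  finally show ?thesis by (simp add: c_def)
qed

section \<open>Preimages of Carleson neighbourhoods\<close>

text \<open>The points w whose averaging disc, of radius half the distance to the circle, contains
  \<zeta>. For fixed w the condition describes a mean value disc; after Tonelli \<zeta> is fixed and
  the set is a Carleson test set.\<close>

definition carleson_nbhd :: "complex \<Rightarrow> complex set"
  where "carleson_nbhd \<zeta> = {w. cmod (\<zeta> - w) < (1 - cmod w) / 2}"

text \<open>By the triangle inequality the distances of w and \<zeta> to the circle differ by less
  than half of the first, which yields the factors 2 and 3/2.\<close>

lemma carleson_nbhdD:
  assumes "w \<in> carleson_nbhd \<zeta>"
  shows "cmod w < 1" "cmod \<zeta> < 1" "cmod (\<zeta> - w) < 1 - cmod \<zeta>"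
    "1 - cmod w \<le> 2 * (1 - cmod \<zeta>)" "1 - cmod \<zeta> \<le> 3 / 2 * (1 - cmod w)"
proof -
  have lt: "cmod (\<zeta> - w) < (1 - cmod w) / 2" using assms by (simp add: carleson_nbhd_def)
  have "cmod \<zeta> \<le> cmod w + cmod (\<zeta> - w)" "cmod w \<le> cmod \<zeta> + cmod (\<zeta> - w)"
    using norm_triangle_sub[of \<zeta> w] norm_triangle_sub[of w \<zeta>] by (auto simp: norm_minus_commute)
  moreover have "0 \<le> cmod (\<zeta> - w)" by simp
  ultimately show "cmod w < 1" "cmod \<zeta> < 1" "cmod (\<zeta> - w) < 1 - cmod \<zeta>"
    "1 - cmod w \<le> 2 * (1 - cmod \<zeta>)" "1 - cmod \<zeta> \<le> 3 / 2 * (1 - cmod w)"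
    using lt unfolding atomize_conj by simp_all
qed

lemma carleson_nbhd_square:
  assumes "w \<in> carleson_nbhd \<zeta>"
  shows "1 - (cmod w)\<^sup>2 \<le> 4 * (1 - cmod \<zeta>)"
proof -
  have "1 - (cmod w)\<^sup>2 = (1 - cmod w) * (1 + cmod w)" by (simp add: power2_eq_square algebra_simps)
  also have "\<dots> \<le> (1 - cmod w) * 2" using carleson_nbhdD(1)[OF assms] by (intro mult_left_mono) auto
  also have "\<dots> \<le> 2 * (1 - cmod \<zeta>) * 2" using carleson_nbhdD(4)[OF assms] by (intro mult_right_mono) auto
  finally show ?thesis by simp
qed

lemma open_carleson_nbhd: "open (carleson_nbhd \<zeta>)"
  unfolding carleson_nbhd_def by (intro open_Collect_less continuous_intros) simp

lemma borel_measurable_ennreal_indicator_open: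
  fixes g :: "'a::{second_countable_topology, t2_space} \<Rightarrow> real"
  assumes "open A" "continuous_on A g"
  shows "(\<lambda>z. ennreal (g z) * indicator A z) \<in> borel_measurable borel"
proof -
  have "(\<lambda>z. indicator A z *\<^sub>R g z) \<in> borel_measurable borel"
    using assms by (intro borel_measurable_continuous_on_indicator) auto
  then have "(\<lambda>z. ennreal (indicator A z *\<^sub>R g z)) \<in> borel_measurable borel"
    by measurable
  then show ?thesis
    by (rule measurable_cong[THEN iffD1, rotated]) (auto simp: indicator_def)
qed

lemma Re_poisson:
  fixes u :: complex
  assumes "u \<noteq> 1"
  shows "Re ((1 + u) / (1 - u)) = (1 - (cmod u)\<^sup>2) / (cmod (1 - u))\<^sup>2"
proof -
  have "(1 + u) / (1 - u) = (1 + u) * cnj (1 - u) / of_real ((cmod (1 - u))\<^sup>2)"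
    using assms by (subst complex_norm_square) simp
  then have "Re ((1 + u) / (1 - u)) = Re ((1 + u) * cnj (1 - u)) / (cmod (1 - u))\<^sup>2"
    by (simp only: Re_divide_of_real)
  also have "Re ((1 + u) * cnj (1 - u)) = 1 - (cmod u)\<^sup>2"
    by (simp only: cmod_power2) (simp add: power2_eq_square algebra_simps)
  finally show ?thesis .
qed

lemma open_carleson_preimage:
  assumes f: "analytic_self_map f"
  shows "open {z \<in> unit_disc. f z \<in> carleson_nbhd \<zeta>}" "{z \<in> unit_disc. f z \<in> carleson_nbhd \<zeta>} \<subseteq> unit_disc"
proof -
  have "{z \<in> unit_disc. f z \<in> carleson_nbhd \<zeta>} = unit_disc \<inter> f -` carleson_nbhd \<zeta>" by auto
  then show "open {z \<in> unit_disc. f z \<in> carleson_nbhd \<zeta>}"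
    using continuous_open_preimage[OF holomorphic_on_imp_continuous_on[OF analytic_self_map_holomorphic[OF f]]
        open_ball open_carleson_nbhd] by simp
qed auto

lemma Schwarz_one_minus_square:
  assumes f: "analytic_self_map f" and f0: "f 0 = 0" and z: "cmod z < 1"
  shows "1 - (cmod z)\<^sup>2 \<le> 1 - (cmod (f z))\<^sup>2"
proof -
  have "cmod (f z) \<le> cmod z"
  proof (rule Schwarz_Lemma(1)[where f = f and \<xi> = z])
    show "cmod (f w) < 1" if "cmod w < 1" for w
      using analytic_self_map_norm[OF f that] .
  qed (use analytic_self_map_holomorphic[OF f] f0 z in simp_all)
  then show ?thesis by (simp add: power_mono)
qed

text \<open>Confinement to an annulus supplies d^(\<gamma> + 1), and the Poisson kernel supplies the
  one missing factor d.\<close>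

lemma preimage_weight_bound:
  assumes f: "analytic_self_map f" and f0: "f 0 = 0" and \<gamma>: "-1 < \<gamma>" and \<zeta>: "cmod \<zeta> < 1"
  shows "(\<integral>\<^sup>+z\<in>{z \<in> unit_disc. f z \<in> carleson_nbhd \<zeta>}. ennreal ((1 - (cmod z)\<^sup>2) powr \<gamma>) \<partial>lborel)
    \<le> ennreal (9 * pi * 4 powr (\<gamma> + 1) / (\<gamma> + 1) * (1 - cmod \<zeta>) powr (\<gamma> + 2))"
proof -
  define d where "d = 1 - cmod \<zeta>"
  have d: "d > 0" using \<zeta> by (simp add: d_def)
  \<comment> \<open>Since \<open>f 0 = 0\<close>, \<open>F 0 = 1\<close>, so the mean of Re F
    carries no constant that depends on f.\<close>
  define F where "F z = (1 + cnj \<zeta> * f z) / (1 - cnj \<zeta> * f z)" for z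
  \<comment> \<open>The cutoff records the width given by Schwarz's lemma; it is radial, so it may
    multiply Re F in \<open>nn_integral_Re_radial\<close>.\<close>
  define W where "W z = ennreal ((1 - (cmod z)\<^sup>2) powr \<gamma>) * indicator {..4 * d} (1 - (cmod z)\<^sup>2)" for z :: complex
  have ne: "1 - cnj \<zeta> * f z \<noteq> 0" if "cmod z < 1" for z
    using disc_aut_denominator_nonzero[OF \<zeta> analytic_self_map_norm[OF f that]] .
  have holF: "F holomorphic_on unit_disc"
    unfolding F_def using analytic_self_map_holomorphic[OF f] ne by (intro holomorphic_intros) auto
  have ReF: "Re (F z) = (1 - (cmod \<zeta> * cmod (f z))\<^sup>2) / (cmod (1 - cnj \<zeta> * f z))\<^sup>2" if "cmod z < 1" for z
    using ne[OF that] unfolding F_def by (subst Re_poisson) (auto simp: norm_mult)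
  have prod: "cmod \<zeta> * cmod (f z) \<le> cmod \<zeta>" if "cmod z < 1" for z
    using mult_left_mono[of "cmod (f z)" 1 "cmod \<zeta>"] analytic_self_map_norm[OF f that] by simp
  have num: "d \<le> 1 - (cmod \<zeta> * cmod (f z))\<^sup>2" if "cmod z < 1" for z
  proof -
    have "(cmod \<zeta> * cmod (f z))\<^sup>2 \<le> (cmod \<zeta>)\<^sup>2" using prod[OF that] by (intro power_mono) auto
    also have "\<dots> \<le> cmod \<zeta>" using \<zeta> by (simp add: power2_eq_square mult_left_le)
    finally show ?thesis by (simp add: d_def)
  qed
  have nonneg: "0 \<le> Re (F z)" if "cmod z < 1" for z
    unfolding ReF[OF that] using num[OF that] d by auto
  have lower: "1 \<le> 9 * d * Re (F z)" if "cmod z < 1" "f z \<in> carleson_nbhd \<zeta>" for z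
  proof -
    \<comment> \<open>The two summands are at most 2d and d, so the squared denominator is at most
      (3d)^2; against a numerator of at least d this gives the factor 9d.\<close>
    have "1 - cnj \<zeta> * f z = (1 - cnj \<zeta> * \<zeta>) + cnj \<zeta> * (\<zeta> - f z)" by (simp add: algebra_simps)
    then have "cmod (1 - cnj \<zeta> * f z) \<le> cmod (1 - cnj \<zeta> * \<zeta>) + cmod \<zeta> * cmod (\<zeta> - f z)"
      by (metis complex_mod_cnj norm_mult norm_triangle_ineq)
    also have "cmod (1 - cnj \<zeta> * \<zeta>) = 1 - (cmod \<zeta>)\<^sup>2"
    proof -
      have "1 - cnj \<zeta> * \<zeta> = of_real (1 - (cmod \<zeta>)\<^sup>2)"
        by (simp flip: complex_norm_square add: mult.commute)
      then show ?thesis using norm_square_less_one[OF \<zeta>] by (simp only: norm_of_real)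
    qed
    also have "1 - (cmod \<zeta>)\<^sup>2 \<le> 2 * d"
    proof -
      have "(1 - cmod \<zeta>) * (1 + cmod \<zeta>) \<le> d * 2"
        using \<zeta> unfolding d_def by (intro mult_left_mono) auto
      then show ?thesis by (simp add: power2_eq_square algebra_simps)
    qed
    also have "cmod \<zeta> * cmod (\<zeta> - f z) \<le> 1 * d"
      using carleson_nbhdD(3)[OF that(2)] \<zeta> unfolding d_def by (intro mult_mono) auto
    finally have "cmod (1 - cnj \<zeta> * f z) \<le> 3 * d" by simp
    then have "(cmod (1 - cnj \<zeta> * f z))\<^sup>2 \<le> (3 * d)\<^sup>2" by (intro power_mono) auto
    then have le9: "(cmod (1 - cnj \<zeta> * f z))\<^sup>2 \<le> 9 * d * d" by (simp add: power2_eq_square)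
    have pos: "0 < (cmod (1 - cnj \<zeta> * f z))\<^sup>2" using ne[OF that(1)] by simp
    have "(cmod (1 - cnj \<zeta> * f z))\<^sup>2 \<le> 9 * d * (1 - (cmod \<zeta> * cmod (f z))\<^sup>2)"
      using le9 mult_left_mono[OF num[OF that(1)], of "9 * d"] d by linarith
    then show ?thesis unfolding ReF[OF that(1)] using pos by (simp add: pos_le_divide_eq)
  qed
  have [measurable]: "W \<in> borel_measurable borel" unfolding W_def by measurable
  have measF: "(\<lambda>z. ennreal (Re (F z)) * indicator unit_disc z) \<in> borel_measurable borel"
    by (intro borel_measurable_ennreal_indicator_open continuous_intros
        holomorphic_on_imp_continuous_on[OF holF]) auto
  have "(\<integral>\<^sup>+z\<in>{z \<in> unit_disc. f z \<in> carleson_nbhd \<zeta>}. ennreal ((1 - (cmod z)\<^sup>2) powr \<gamma>) \<partial>lborel)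
      \<le> (\<integral>\<^sup>+z. ennreal (9 * d) * ((ennreal (Re (F z)) * indicator unit_disc z) * W z) \<partial>lborel)"
  proof (intro nn_integral_mono)
    fix z :: complex
    show "ennreal ((1 - (cmod z)\<^sup>2) powr \<gamma>) * indicator {z \<in> unit_disc. f z \<in> carleson_nbhd \<zeta>} z
      \<le> ennreal (9 * d) * ((ennreal (Re (F z)) * indicator unit_disc z) * W z)"
    proof (cases "z \<in> unit_disc \<and> f z \<in> carleson_nbhd \<zeta>")
      case True
      then have z: "cmod z < 1" and fz: "f z \<in> carleson_nbhd \<zeta>" by auto
      have "1 - (cmod z)\<^sup>2 \<le> 4 * d"
        unfolding d_def by (rule order_trans[OF Schwarz_one_minus_square[OF f f0 z] carleson_nbhd_square[OF fz]])
      then have Wz: "W z = ennreal ((1 - (cmod z)\<^sup>2) powr \<gamma>)" by (simp add: W_def)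
      have "1 * ennreal ((1 - (cmod z)\<^sup>2) powr \<gamma>) \<le> ennreal (9 * d * Re (F z)) * ennreal ((1 - (cmod z)\<^sup>2) powr \<gamma>)"
        using lower[OF z fz] by (intro mult_right_mono) (auto simp: ennreal_leI simp flip: ennreal_1)
      then show ?thesis using True d z nonneg[OF z] by (simp add: Wz ennreal_mult mult_ac)
    qed simp
  qed
  also have "\<dots> = ennreal (9 * d) * (\<integral>\<^sup>+z. (ennreal (Re (F z)) * indicator unit_disc z) * W z \<partial>lborel)"
    using measF by (intro nn_integral_cmult) simp
  also have "(\<integral>\<^sup>+z. (ennreal (Re (F z)) * indicator unit_disc z) * W z \<partial>lborel) =
      (\<integral>\<^sup>+z\<in>unit_disc. ennreal (Re (F z)) * W z \<partial>lborel)"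
    by (simp add: mult_ac)
  also have "\<dots> = ennreal (Re (F 0)) * (\<integral>\<^sup>+z\<in>unit_disc. W z \<partial>lborel)"
    by (rule nn_integral_Re_radial[OF holF nonneg]) (auto simp: W_def norm_mult)
  also have "\<dots> = (\<integral>\<^sup>+z\<in>unit_disc. W z \<partial>lborel)" by (simp add: F_def f0)
  also have "\<dots> \<le> ennreal (pi * (4 * d) powr (\<gamma> + 1) / (\<gamma> + 1))"
    unfolding W_def using nn_integral_boundary_annulus[OF \<gamma>, of "4 * d"] d by (simp add: mult_ac)
  finally have "(\<integral>\<^sup>+z\<in>{z \<in> unit_disc. f z \<in> carleson_nbhd \<zeta>}. ennreal ((1 - (cmod z)\<^sup>2) powr \<gamma>) \<partial>lborel)
      \<le> ennreal (9 * d) * ennreal (pi * (4 * d) powr (\<gamma> + 1) / (\<gamma> + 1))"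
    by (simp add: mult_left_mono)
  also have "\<dots> = ennreal (9 * d * (pi * (4 * d) powr (\<gamma> + 1) / (\<gamma> + 1)))"
    using d \<gamma> by (subst ennreal_mult) auto
  also have "9 * d * (pi * (4 * d) powr (\<gamma> + 1) / (\<gamma> + 1)) = 9 * pi * 4 powr (\<gamma> + 1) / (\<gamma> + 1) * (d * d powr (\<gamma> + 1))"
    using d by (simp add: powr_mult)
  also have "d * d powr (\<gamma> + 1) = d powr (\<gamma> + 2)"
    using d powr_add[of d 1 "\<gamma> + 1"] by (simp add: add.commute)
  finally show ?thesis by (simp add: d_def)
qed

text \<open>The neighbourhood lies in the Euclidean disc about \<zeta> of radius 1 - |\<zeta>|, and
  by injectivity the integral is an area inside that disc.\<close>

lemma preimage_area_bound:
  assumes f: "analytic_self_map f" and inj: "inj_on f unit_disc" and \<zeta>: "cmod \<zeta> < 1"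
  shows "(\<integral>\<^sup>+z\<in>{z \<in> unit_disc. f z \<in> carleson_nbhd \<zeta>}. ennreal ((cmod (deriv f z))\<^sup>2) \<partial>lborel)
    \<le> ennreal (pi * (1 - cmod \<zeta>)\<^sup>2)"
proof -
  let ?E = "{z \<in> unit_disc. f z \<in> carleson_nbhd \<zeta>}"
  have sub: "f ` ?E \<subseteq> ball \<zeta> (1 - cmod \<zeta>)"
    using carleson_nbhdD(3) by (auto simp: dist_norm)
  have "(\<integral>\<^sup>+z\<in>?E. ennreal ((cmod (deriv f z))\<^sup>2) \<partial>lborel) = emeasure lborel (f ` ?E)"
  proof (rule nn_integral_deriv_square_injective[OF open_carleson_preimage(1)[OF f]])
    show "f holomorphic_on ?E"
      using analytic_self_map_holomorphic[OF f] open_carleson_preimage(2)[OF f] by (rule holomorphic_on_subset)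
    show "inj_on f ?E" using inj open_carleson_preimage(2)[OF f] by (rule inj_on_subset)
    show "bounded (f ` ?E)" using sub bounded_subset bounded_ball by blast
  qed
  also have "\<dots> \<le> emeasure lborel (ball \<zeta> (1 - cmod \<zeta>))"
    by (rule emeasure_mono[OF sub]) simp
  also have "\<dots> = ennreal (pi * (1 - cmod \<zeta>)\<^sup>2)"
    using \<zeta> by (simp add: emeasure_ball unit_ball_vol_2 ennreal_mult)
  finally show ?thesis .
qed

section \<open>Mass of preimages in the three parameter ranges\<close>

lemma preimage_mass_large_exponent:
  assumes f: "analytic_self_map f" and f0: "f 0 = 0" and p: "0 < p" and s: "p - 1 < s" and \<zeta>: "cmod \<zeta> < 1"
  shows "(\<integral>\<^sup>+z\<in>{z \<in> unit_disc. f z \<in> carleson_nbhd \<zeta>}. ennreal (D_density p s f z) \<partial>lborel)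
    \<le> ennreal (4 powr p * (9 * pi * 4 powr (s - p + 1) / (s - p + 1)) * (1 - cmod \<zeta>) powr (s + 2))"
proof -
  let ?E = "{z \<in> unit_disc. f z \<in> carleson_nbhd \<zeta>}"
  define d where "d = 1 - cmod \<zeta>"
  have d: "d > 0" using \<zeta> by (simp add: d_def)
  have "(\<integral>\<^sup>+z\<in>?E. ennreal (D_density p s f z) \<partial>lborel)
    \<le> (\<integral>\<^sup>+z. ennreal ((4 * d) powr p) * (ennreal ((1 - (cmod z)\<^sup>2) powr (s - p)) * indicator ?E z) \<partial>lborel)"
  proof (intro nn_integral_mono)
    fix z
    show "ennreal (D_density p s f z) * indicator ?E z \<le>
      ennreal ((4 * d) powr p) * (ennreal ((1 - (cmod z)\<^sup>2) powr (s - p)) * indicator ?E z)"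
    proof (cases "z \<in> ?E")
      case True
      then have z: "cmod z < 1" and fz: "f z \<in> carleson_nbhd \<zeta>" by auto
      define r where "r = 1 - (cmod z)\<^sup>2"
      have r: "r > 0" using norm_square_less_one[OF z] by (simp add: r_def)
      have "cmod (deriv f z) * r \<le> 4 * d"
        unfolding r_def d_def
        by (rule order_trans[OF Schwarz_Pick_deriv[OF f z] carleson_nbhd_square[OF fz]])
      then have le: "(cmod (deriv f z) * r) powr p \<le> (4 * d) powr p"
        using r p by (intro powr_mono2) auto
      have "D_density p s f z = (cmod (deriv f z) * r) powr p * r powr (s - p)"
        using r by (simp add: D_density_def powr_mult powr_diff flip: r_def)
      also have "\<dots> \<le> (4 * d) powr p * r powr (s - p)" by (intro mult_right_mono le) simp
      finally show ?thesis using True by (simp add: r_def ennreal_leI flip: ennreal_mult)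
    qed simp
  qed
  also have "\<dots> = ennreal ((4 * d) powr p) * (\<integral>\<^sup>+z\<in>?E. ennreal ((1 - (cmod z)\<^sup>2) powr (s - p)) \<partial>lborel)"
    using open_carleson_preimage(1)[OF f] by (intro nn_integral_cmult) measurable
  also have "\<dots> \<le> ennreal ((4 * d) powr p) *
      ennreal (9 * pi * 4 powr (s - p + 1) / (s - p + 1) * d powr (s - p + 2))"
    using preimage_weight_bound[OF f f0 _ \<zeta>, of "s - p"] s by (intro mult_left_mono) (auto simp: d_def)
  also have "\<dots> = ennreal ((4 * d) powr p * (9 * pi * 4 powr (s - p + 1) / (s - p + 1) * d powr (s - p + 2)))"
    by (simp flip: ennreal_mult')
  also have "(4 * d) powr p * (9 * pi * 4 powr (s - p + 1) / (s - p + 1) * d powr (s - p + 2)) =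
     4 powr p * (9 * pi * 4 powr (s - p + 1) / (s - p + 1)) * (d powr p * d powr (s - p + 2))"
    using d by (simp add: powr_mult)
  also have "d powr p * d powr (s - p + 2) = d powr (s + 2)" by (simp flip: powr_add)
  finally show ?thesis by (simp add: d_def)
qed

lemma preimage_mass_univalent_large:
  assumes f: "analytic_self_map f" and f0: "f 0 = 0" and inj: "inj_on f unit_disc"
    and p: "2 \<le> p" and s: "p - 2 < s" and \<zeta>: "cmod \<zeta> < 1"
  shows "(\<integral>\<^sup>+z\<in>{z \<in> unit_disc. f z \<in> carleson_nbhd \<zeta>}. ennreal (D_density p s f z) \<partial>lborel)
    \<le> ennreal (4 powr s * pi * (1 - cmod \<zeta>) powr (s + 2))"
proof -
  let ?E = "{z \<in> unit_disc. f z \<in> carleson_nbhd \<zeta>}"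
  define d where "d = 1 - cmod \<zeta>"
  have d: "d > 0" using \<zeta> by (simp add: d_def)
  have "(\<integral>\<^sup>+z\<in>?E. ennreal (D_density p s f z) \<partial>lborel)
    \<le> (\<integral>\<^sup>+z. ennreal ((4 * d) powr s) * (ennreal ((cmod (deriv f z))\<^sup>2) * indicator ?E z) \<partial>lborel)"
  proof (intro nn_integral_mono)
    fix z
    show "ennreal (D_density p s f z) * indicator ?E z \<le>
      ennreal ((4 * d) powr s) * (ennreal ((cmod (deriv f z))\<^sup>2) * indicator ?E z)"
    proof (cases "z \<in> ?E")
      case True
      then have z: "cmod z < 1" and fz: "f z \<in> carleson_nbhd \<zeta>" by auto
      define r where "r = 1 - (cmod z)\<^sup>2"
      define m where "m = 1 - (cmod (f z))\<^sup>2"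
      define x where "x = cmod (deriv f z)"
      have r: "r > 0" using norm_square_less_one[OF z] by (simp add: r_def)
      have m: "m > 0" using norm_square_less_one[OF analytic_self_map_norm[OF f z]] by (simp add: m_def)
      have xr: "x * r \<le> m" unfolding r_def m_def x_def by (rule Schwarz_Pick_deriv[OF f z])
      have rm: "r \<le> m" unfolding r_def m_def by (rule Schwarz_one_minus_square[OF f f0 z])
      have md: "m \<le> 4 * d" unfolding m_def d_def by (rule carleson_nbhd_square[OF fz])
      have x: "0 \<le> x" by (simp add: x_def)
      \<comment> \<open>Two powers of the derivative are kept for the area. The other p - 2 are
        paired with r, which leaves r the exponent s - p + 2; monotonicity needs both exponents
        nonnegative.\<close>
      have "x powr p * r powr s = x powr (2 + (p - 2)) * r powr ((p - 2) + (s - p + 2))" by simp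
      also have "\<dots> = x\<^sup>2 * ((x * r) powr (p - 2) * r powr (s - p + 2))"
        unfolding powr_add using x r by (simp add: powr_mult)
      also have "\<dots> \<le> x\<^sup>2 * (m powr (p - 2) * m powr (s - p + 2))"
        using x r m xr rm p s by (intro mult_left_mono mult_mono powr_mono2) auto
      also have "m powr (p - 2) * m powr (s - p + 2) = m powr s"
        by (simp flip: powr_add)
      also have "x\<^sup>2 * m powr s \<le> x\<^sup>2 * (4 * d) powr s"
        using m md p s by (intro mult_left_mono powr_mono2) auto
      finally have "D_density p s f z \<le> (4 * d) powr s * x\<^sup>2"
        by (simp add: D_density_def mult.commute flip: r_def x_def)
      then show ?thesis using True by (simp add: x_def ennreal_leI flip: ennreal_mult)
    qed simp
  qed
  also have "\<dots> = ennreal ((4 * d) powr s) * (\<integral>\<^sup>+z\<in>?E. ennreal ((cmod (deriv f z))\<^sup>2) \<partial>lborel)"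
    using open_carleson_preimage[OF f]
    by (intro nn_integral_cmult measurable_lborel2[THEN equalityD2, THEN subsetD]
        borel_measurable_ennreal_indicator_open continuous_intros
        holomorphic_on_imp_continuous_on holomorphic_on_subset[OF holomorphic_deriv[OF analytic_self_map_holomorphic[OF f]]]) auto
  also have "\<dots> \<le> ennreal ((4 * d) powr s) * ennreal (pi * d\<^sup>2)"
    using preimage_area_bound[OF f inj \<zeta>] by (intro mult_left_mono) (auto simp: d_def)
  also have "\<dots> = ennreal ((4 * d) powr s * (pi * d\<^sup>2))" by (simp flip: ennreal_mult')
  also have "(4 * d) powr s * (pi * d\<^sup>2) = 4 powr s * pi * (d powr s * d powr 2)"
    using d by (simp add: powr_mult)
  also have "d powr s * d powr 2 = d powr (s + 2)" by (simp flip: powr_add)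
  finally show ?thesis by (simp add: d_def)
qed

text \<open>For p < 2 the exponent p - 2 is negative, so surplus powers of the derivative cannot be
  paired with r. Derivative and weight are bounded separately, the weight by (4d)^s, which uses s >=
  0.\<close>

lemma preimage_mass_univalent_small:
  assumes f: "analytic_self_map f" and f0: "f 0 = 0" and inj: "inj_on f unit_disc"
    and p: "0 < p" "p \<le> 2" and s: "0 \<le> s" and \<zeta>: "cmod \<zeta> < 1"
  shows "(\<integral>\<^sup>+z\<in>{z \<in> unit_disc. f z \<in> carleson_nbhd \<zeta>}. ennreal (D_density p s f z) \<partial>lborel)
    \<le> ennreal (4 powr s * (37 * pi) * (1 - cmod \<zeta>) powr (s + 2))"
proof -
  let ?E = "{z \<in> unit_disc. f z \<in> carleson_nbhd \<zeta>}"
  define d where "d = 1 - cmod \<zeta>"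
  have d: "d > 0" using \<zeta> by (simp add: d_def)
  have meas: "(\<lambda>z. ennreal ((cmod (deriv f z))\<^sup>2) * indicator ?E z) \<in> borel_measurable lborel"
    unfolding measurable_lborel2 using open_carleson_preimage[OF f]
    by (intro borel_measurable_ennreal_indicator_open continuous_intros
        holomorphic_on_imp_continuous_on holomorphic_on_subset[OF holomorphic_deriv[OF analytic_self_map_holomorphic[OF f]]]) auto
  \<comment> \<open>The weight with exponent 0 is 1 on the disc; it is written so as to match
    \<open>preimage_weight_bound\<close> at \<gamma> = 0.\<close>
  have meas1: "(\<lambda>z. ennreal ((1 - (cmod z)\<^sup>2) powr 0) * indicator ?E z) \<in> borel_measurable lborel"
  proof -
    have "(\<lambda>z::complex. ennreal ((1 - (cmod z)\<^sup>2) powr 0) * indicator A z) \<in> borel_measurable lborel"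
      if "A \<in> sets borel" for A
      using that by measurable
    then show ?thesis using borel_open[OF open_carleson_preimage(1)[OF f]] by blast
  qed
  have "(\<integral>\<^sup>+z\<in>?E. ennreal (D_density p s f z) \<partial>lborel)
    \<le> (\<integral>\<^sup>+z. ennreal ((4 * d) powr s) * (ennreal ((cmod (deriv f z))\<^sup>2) * indicator ?E z
        + ennreal ((1 - (cmod z)\<^sup>2) powr 0) * indicator ?E z) \<partial>lborel)"
  proof (intro nn_integral_mono)
    fix z
    show "ennreal (D_density p s f z) * indicator ?E z \<le>
      ennreal ((4 * d) powr s) * (ennreal ((cmod (deriv f z))\<^sup>2) * indicator ?E z
        + ennreal ((1 - (cmod z)\<^sup>2) powr 0) * indicator ?E z)"
    proof (cases "z \<in> ?E")
      case True
      then have z: "cmod z < 1" and fz: "f z \<in> carleson_nbhd \<zeta>" by auto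
      define r where "r = 1 - (cmod z)\<^sup>2"
      define x where "x = cmod (deriv f z)"
      have r: "r > 0" using norm_square_less_one[OF z] by (simp add: r_def)
      have rd: "r \<le> 4 * d" unfolding r_def d_def
        by (rule order_trans[OF Schwarz_one_minus_square[OF f f0 z] carleson_nbhd_square[OF fz]])
      have x: "0 \<le> x" by (simp add: x_def)
      have "x powr p \<le> x\<^sup>2 + 1"
      proof (cases "x \<le> 1")
        case True
        then have "x powr p \<le> 1" using x p by (intro powr_le1) auto
        then show ?thesis by (rule order_trans) simp
      next
        case False
        then have "x powr p \<le> x powr 2" using p by (intro powr_mono) auto
        then show ?thesis using False by simp
      qed
      then have "x powr p * r powr s \<le> (x\<^sup>2 + 1) * (4 * d) powr s"
        using r rd s by (intro mult_mono powr_mono2) auto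
      then have "D_density p s f z \<le> (4 * d) powr s * (x\<^sup>2 + 1)"
        by (simp add: D_density_def mult.commute flip: r_def x_def)
      then have "ennreal (D_density p s f z) \<le> ennreal ((4 * d) powr s * (x\<^sup>2 + 1))" by (rule ennreal_leI)
      also have "\<dots> = ennreal ((4 * d) powr s) * (ennreal (x\<^sup>2) + 1)"
        by (simp add: ennreal_mult' ennreal_plus flip: ennreal_1)
      finally show ?thesis using True r by (simp add: x_def r_def)
    qed simp
  qed
  also have "\<dots> = ennreal ((4 * d) powr s) * ((\<integral>\<^sup>+z\<in>?E. ennreal ((cmod (deriv f z))\<^sup>2) \<partial>lborel)
      + (\<integral>\<^sup>+z\<in>?E. ennreal ((1 - (cmod z)\<^sup>2) powr 0) \<partial>lborel))"
    unfolding nn_integral_add[OF meas meas1, symmetric]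
    by (rule nn_integral_cmult[OF borel_measurable_add[OF meas meas1]])
  \<comment> \<open>36 = 9 * 4 is the constant of \<open>preimage_weight_bound\<close> at \<gamma> =
    0; the area term brings the sum to 37.\<close>
  also have "\<dots> \<le> ennreal ((4 * d) powr s) * (ennreal (pi * d\<^sup>2) + ennreal (36 * pi * d\<^sup>2))"
    using preimage_area_bound[OF f inj \<zeta>] preimage_weight_bound[OF f f0 _ \<zeta>, of 0] d
    by (intro mult_left_mono add_mono) (auto simp: d_def)
  also have "\<dots> = ennreal ((4 * d) powr s * (37 * pi * d\<^sup>2))"
    by (simp flip: ennreal_mult' ennreal_plus)
  also have "(4 * d) powr s * (37 * pi * d\<^sup>2) = 4 powr s * (37 * pi) * (d powr s * d powr 2)"
    using d by (simp add: powr_mult)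
  also have "d powr s * d powr 2 = d powr (s + 2)" by (simp flip: powr_add)
  finally show ?thesis by (simp add: d_def)
qed

text \<open>The constant is chosen before the map and the point, because one value has to serve the
  conjugates psi of all symbols at all points a.\<close>

lemma preimage_mass_bound:
  assumes p: "1 < p" and s: "p - 2 < s"
  obtains C where "C > 0"
    and "\<And>f \<zeta>. analytic_self_map f \<Longrightarrow> f 0 = 0 \<Longrightarrow>
      p - 1 < s \<or> univalent f \<and> admissible_univalent_params p s \<Longrightarrow> cmod \<zeta> < 1 \<Longrightarrow>
      (\<integral>\<^sup>+z\<in>{z \<in> unit_disc. f z \<in> carleson_nbhd \<zeta>}. ennreal (D_density p s f z) \<partial>lborel)
        \<le> ennreal (C * (1 - cmod \<zeta>) powr (s + 2))"
proof (cases "p - 1 < s")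
  case True
  show thesis
    by (rule that[OF _ preimage_mass_large_exponent]) (use True p in auto)
next
  case False
  show thesis
  proof (cases "2 \<le> p")
    case True
    show thesis
      by (rule that[OF _ preimage_mass_univalent_large]) (use True False s in \<open>auto simp: univalent_def\<close>)
  next
    case p2: False
    show thesis
      by (rule that[OF _ preimage_mass_univalent_small])
         (use False p2 p in \<open>auto simp: univalent_def admissible_univalent_params_def\<close>)
  qed
qed

text \<open>The mean value inequality on the disc of radius R about w, rewritten with a density in
  \<zeta> alone, so that w survives only in the incidence relation. The factor 9 / pi comes from the
  area pi R^2 and 1 - |\<zeta>| <= 3R.\<close>

lemma powr_le_carleson_average:
  assumes h: "h holomorphic_on unit_disc" and p: "1 \<le> p" and w: "cmod w < 1"
  shows "ennreal (cmod (h w) powr p) \<le>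
    (\<integral>\<^sup>+\<zeta>\<in>unit_disc. ennreal (9 / pi * (cmod (h \<zeta>) powr p / (1 - cmod \<zeta>)\<^sup>2)) *
       indicator {\<zeta>. w \<in> carleson_nbhd \<zeta>} \<zeta> \<partial>lborel)"
proof -
  define R where "R = (1 - cmod w) / 2"
  have R: "R > 0" using w by (simp add: R_def)
  have near: "w \<in> carleson_nbhd \<zeta> \<longleftrightarrow> \<zeta> - w \<in> ball 0 R" for \<zeta>
    by (simp add: carleson_nbhd_def R_def)
  have sub: "ball w R \<subseteq> unit_disc"
  proof
    fix z assume "z \<in> ball w R"
    then have "w \<in> carleson_nbhd z" by (simp add: near dist_norm norm_minus_commute)
    then show "z \<in> unit_disc" using carleson_nbhdD by simp
  qed
  have cont: "continuous_on (ball w R) (\<lambda>\<zeta>. cmod (h \<zeta>) powr p)"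
    using holomorphic_on_imp_continuous_on[OF holomorphic_on_subset[OF h sub]] p
    by (intro continuous_on_powr' continuous_on_norm continuous_on_const) auto
  have "(\<lambda>z. h (w + z)) holomorphic_on ball 0 R"
  proof (rule holomorphic_on_compose_gen[of "\<lambda>z. w + z" _ h unit_disc, unfolded o_def])
    show "(\<lambda>z. w + z) ` ball 0 R \<subseteq> unit_disc"
      using sub by (auto simp: dist_norm subset_iff)
  qed (auto intro!: holomorphic_intros h)
  from powr_radial_mean[OF this p, of "\<lambda>_. 1"]
  have "ennreal (cmod (h w) powr p) * emeasure lborel (ball (0::complex) R) \<le>
    (\<integral>\<^sup>+z\<in>ball 0 R. ennreal (cmod (h (w + z)) powr p) \<partial>lborel)" by simp
  also have "emeasure lborel (ball (0::complex) R) = ennreal (pi * R\<^sup>2)"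
    using R by (simp add: emeasure_ball unit_ball_vol_2 ennreal_mult)
  also have "(\<integral>\<^sup>+z\<in>ball 0 R. ennreal (cmod (h (w + z)) powr p) \<partial>lborel) =
     (\<integral>\<^sup>+\<zeta>\<in>ball w R. ennreal (cmod (h \<zeta>) powr p) \<partial>lborel)"
  proof -
    have "(\<integral>\<^sup>+\<zeta>\<in>ball w R. ennreal (cmod (h \<zeta>) powr p) \<partial>distr lborel borel ((+) w)) =
       (\<integral>\<^sup>+z. ennreal (cmod (h (w + z)) powr p) * indicator (ball w R) (w + z) \<partial>lborel)"
      using borel_measurable_ennreal_indicator_open[OF open_ball cont]
      by (intro nn_integral_distr) auto
    also have "\<dots> = (\<integral>\<^sup>+z\<in>ball 0 R. ennreal (cmod (h (w + z)) powr p) \<partial>lborel)"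
      by (intro nn_integral_cong) (simp add: indicator_def dist_norm)
    finally show ?thesis by (simp add: lborel_distr_plus)
  qed
  finally have *: "ennreal (cmod (h w) powr p) * ennreal (pi * R\<^sup>2) \<le>
     (\<integral>\<^sup>+\<zeta>\<in>ball w R. ennreal (cmod (h \<zeta>) powr p) \<partial>lborel)" .
  have "ennreal (cmod (h w) powr p) = ennreal (1 / (pi * R\<^sup>2)) * (ennreal (cmod (h w) powr p) * ennreal (pi * R\<^sup>2))"
    using R by (simp add: field_simps flip: ennreal_mult)
  also have "\<dots> \<le> ennreal (1 / (pi * R\<^sup>2)) * (\<integral>\<^sup>+\<zeta>\<in>ball w R. ennreal (cmod (h \<zeta>) powr p) \<partial>lborel)"
    by (intro mult_left_mono *) simp
  also have "\<dots> = (\<integral>\<^sup>+\<zeta>. ennreal (1 / (pi * R\<^sup>2)) * (ennreal (cmod (h \<zeta>) powr p) * indicator (ball w R) \<zeta>) \<partial>lborel)"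
    using borel_measurable_ennreal_indicator_open[OF open_ball cont]
    by (intro nn_integral_cmult[symmetric]) simp
  also have "\<dots> \<le> (\<integral>\<^sup>+\<zeta>\<in>unit_disc. ennreal (9 / pi * (cmod (h \<zeta>) powr p / (1 - cmod \<zeta>)\<^sup>2)) *
       indicator {\<zeta>. w \<in> carleson_nbhd \<zeta>} \<zeta> \<partial>lborel)"
  proof (intro nn_integral_mono)
    fix \<zeta>
    show "ennreal (1 / (pi * R\<^sup>2)) * (ennreal (cmod (h \<zeta>) powr p) * indicator (ball w R) \<zeta>) \<le>
      ennreal (9 / pi * (cmod (h \<zeta>) powr p / (1 - cmod \<zeta>)\<^sup>2)) *
       indicator {\<zeta>. w \<in> carleson_nbhd \<zeta>} \<zeta> * indicator unit_disc \<zeta>"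
    proof (cases "\<zeta> \<in> ball w R")
      case True
      then have wn: "w \<in> carleson_nbhd \<zeta>" by (simp add: near dist_norm norm_minus_commute)
      have pos: "0 < 1 - cmod \<zeta>" using carleson_nbhdD(2)[OF wn] by simp
      have "1 - cmod \<zeta> \<le> 3 * R" using carleson_nbhdD(5)[OF wn] by (simp add: R_def)
      then have "(1 - cmod \<zeta>)\<^sup>2 \<le> (3 * R)\<^sup>2" using pos by (intro power_mono) auto
      then have "1 / (3 * R)\<^sup>2 \<le> 1 / (1 - cmod \<zeta>)\<^sup>2"
        using pos R by (intro divide_left_mono) auto
      then have "9 / pi * cmod (h \<zeta>) powr p * (1 / (3 * R)\<^sup>2) \<le> 9 / pi * cmod (h \<zeta>) powr p * (1 / (1 - cmod \<zeta>)\<^sup>2)"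
        by (intro mult_left_mono) auto
      then have "1 / (pi * R\<^sup>2) * cmod (h \<zeta>) powr p \<le> 9 / pi * (cmod (h \<zeta>) powr p / (1 - cmod \<zeta>)\<^sup>2)"
        by (simp add: power_mult_distrib)
      then show ?thesis using True wn sub
        by (auto simp: ennreal_leI simp flip: ennreal_mult)
    qed simp
  qed
  finally show ?thesis .
qed

section \<open>The Carleson embedding\<close>

lemma continuous_on_disc_weight: "continuous_on unit_disc (\<lambda>z::complex. (1 - (cmod z)\<^sup>2) powr s)"
proof (rule continuous_on_powr)
  show "\<forall>z\<in>unit_disc. 1 - (cmod z)\<^sup>2 \<noteq> 0"
    using norm_square_less_one by force
qed (intro continuous_intros)+

lemma continuous_on_D_density:
  assumes f: "f holomorphic_on unit_disc" and p: "0 < p"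
  shows "continuous_on unit_disc (D_density p s f)"
  unfolding D_density_def
  using holomorphic_on_imp_continuous_on[OF holomorphic_deriv[OF f open_ball]] p
  by (intro continuous_on_mult continuous_on_disc_weight continuous_on_powr' continuous_on_norm
      continuous_on_const) auto

lemma D_density_nonneg: "0 \<le> D_density p s f z"
  by (simp add: D_density_def)

lemma carleson_embedding:
  assumes f: "analytic_self_map f" and h: "h holomorphic_on unit_disc"
    and p: "1 \<le> p" and s: "0 \<le> s" and C: "0 \<le> C"
    and mass: "\<And>\<zeta>. cmod \<zeta> < 1 \<Longrightarrow>
      (\<integral>\<^sup>+z\<in>{z \<in> unit_disc. f z \<in> carleson_nbhd \<zeta>}. ennreal (D_density p s f z) \<partial>lborel)
        \<le> ennreal (C * (1 - cmod \<zeta>) powr (s + 2))"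
  shows "(\<integral>\<^sup>+z\<in>unit_disc. ennreal (cmod (h (f z)) powr p * D_density p s f z) \<partial>lborel)
    \<le> ennreal (9 * C / pi) *
      (\<integral>\<^sup>+z\<in>unit_disc. ennreal (cmod (h z) powr p * (1 - (cmod z)\<^sup>2) powr s) \<partial>lborel)"
proof -
  define H where "H \<zeta> = ennreal (9 / pi * (cmod (h \<zeta>) powr p / (1 - cmod \<zeta>)\<^sup>2)) * indicator unit_disc \<zeta>" for \<zeta>
  \<comment> \<open>The values of f off the disc are arbitrary; its extension by zero is
    Borel.\<close>
  define f0 where "f0 z = indicator unit_disc z *\<^sub>R f z" for z
  define u where "u z = ennreal (D_density p s f z) * indicator unit_disc z" for z
  \<comment> \<open>The incidence relation as a 0-1 kernel, in a form whose joint measurability is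
    immediate.\<close>
  define K where "K \<zeta> z = (if cmod (\<zeta> - f0 z) < (1 - cmod (f0 z)) / 2 then 1 else 0 :: ennreal)" for \<zeta> z
  have conth: "continuous_on unit_disc (\<lambda>\<zeta>. cmod (h \<zeta>) powr p)"
    using p by (intro continuous_on_powr' continuous_on_norm continuous_on_const
        holomorphic_on_imp_continuous_on[OF h]) auto
  have [measurable]: "H \<in> borel_measurable borel"
    unfolding H_def
    by (intro borel_measurable_ennreal_indicator_open continuous_on_mult continuous_on_divide conth
        continuous_on_const continuous_on_power continuous_on_diff continuous_on_norm continuous_on_id) auto
  have [measurable]: "f0 \<in> borel_measurable borel"
    unfolding f0_def
    by (intro borel_measurable_continuous_on_indicator holomorphic_on_imp_continuous_on
        analytic_self_map_holomorphic f) auto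
  have [measurable]: "u \<in> borel_measurable borel"
    unfolding u_def using p
    by (intro borel_measurable_ennreal_indicator_open continuous_on_D_density
        analytic_self_map_holomorphic f) auto
  have K_eq: "K \<zeta> z * u z = ennreal (D_density p s f z) * indicator {z \<in> unit_disc. f z \<in> carleson_nbhd \<zeta>} z"
    for \<zeta> z
    by (simp add: K_def u_def f0_def carleson_nbhd_def indicator_def)
  have "(\<integral>\<^sup>+z\<in>unit_disc. ennreal (cmod (h (f z)) powr p * D_density p s f z) \<partial>lborel)
      \<le> (\<integral>\<^sup>+z. (\<integral>\<^sup>+\<zeta>. H \<zeta> * K \<zeta> z * u z \<partial>lborel) \<partial>lborel)"
  proof (intro nn_integral_mono)
    fix z :: complex
    show "ennreal (cmod (h (f z)) powr p * D_density p s f z) * indicator unit_disc z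
      \<le> (\<integral>\<^sup>+\<zeta>. H \<zeta> * K \<zeta> z * u z \<partial>lborel)"
    proof (cases "z \<in> unit_disc")
      case True
      then have "cmod (f z) < 1" using analytic_self_map_norm[OF f] by simp
      from powr_le_carleson_average[OF h p this]
      have "ennreal (cmod (h (f z)) powr p) \<le> (\<integral>\<^sup>+\<zeta>. H \<zeta> * K \<zeta> z \<partial>lborel)"
        using True by (simp add: H_def K_def f0_def carleson_nbhd_def indicator_def of_bool_def mult_ac cong: if_cong)
      then have "ennreal (cmod (h (f z)) powr p) * u z \<le> (\<integral>\<^sup>+\<zeta>. H \<zeta> * K \<zeta> z \<partial>lborel) * u z"
        by (rule mult_right_mono) simp
      also have "\<dots> = (\<integral>\<^sup>+\<zeta>. H \<zeta> * K \<zeta> z * u z \<partial>lborel)"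
        unfolding K_def by (intro nn_integral_multc[symmetric]) measurable
      finally show ?thesis using True by (simp add: u_def ennreal_mult' D_density_nonneg)
    qed simp
  qed
  also have "\<dots> = (\<integral>\<^sup>+\<zeta>. (\<integral>\<^sup>+z. H \<zeta> * K \<zeta> z * u z \<partial>lborel) \<partial>lborel)"
    unfolding K_def by (rule lborel_pair.Fubini') measurable
  also have "\<dots> \<le> (\<integral>\<^sup>+\<zeta>. ennreal (9 * C / pi) *
      (ennreal (cmod (h \<zeta>) powr p * (1 - (cmod \<zeta>)\<^sup>2) powr s) * indicator unit_disc \<zeta>) \<partial>lborel)"
  proof (intro nn_integral_mono)
    fix \<zeta> :: complex
    have "(\<integral>\<^sup>+z. H \<zeta> * K \<zeta> z * u z \<partial>lborel) = H \<zeta> * (\<integral>\<^sup>+z. K \<zeta> z * u z \<partial>lborel)"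
      unfolding K_def by (subst nn_integral_cmult[symmetric]) (auto simp: mult_ac)
    also have "\<dots> \<le> ennreal (9 * C / pi) *
      (ennreal (cmod (h \<zeta>) powr p * (1 - (cmod \<zeta>)\<^sup>2) powr s) * indicator unit_disc \<zeta>)"
    proof (cases "\<zeta> \<in> unit_disc")
      case True
      then have \<zeta>: "cmod \<zeta> < 1" by simp
      define d where "d = 1 - cmod \<zeta>"
      have d: "d > 0" using \<zeta> by (simp add: d_def)
      have "(cmod \<zeta>)\<^sup>2 \<le> cmod \<zeta>" using \<zeta> by (simp add: power2_eq_square mult_left_le)
      then have dle: "d \<le> 1 - (cmod \<zeta>)\<^sup>2" by (simp add: d_def)
      have "H \<zeta> * (\<integral>\<^sup>+z. K \<zeta> z * u z \<partial>lborel) \<le> H \<zeta> * ennreal (C * d powr (s + 2))"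
        unfolding K_eq d_def by (intro mult_left_mono mass \<zeta>) simp
      also have "\<dots> = ennreal (9 / pi * (cmod (h \<zeta>) powr p / d\<^sup>2) * (C * d powr (s + 2)))"
        using \<zeta> by (simp add: H_def d_def flip: ennreal_mult')
      \<comment> \<open>The division by d^2 in the averages cancels two of the s + 2 powers in
        \<open>mass\<close>; the remaining d^s is compared with the weight by s >= 0.\<close>
      also have "9 / pi * (cmod (h \<zeta>) powr p / d\<^sup>2) * (C * d powr (s + 2)) =
          9 * C / pi * (cmod (h \<zeta>) powr p * d powr s)"
        using d by (simp add: powr_add)
      also have "ennreal (9 * C / pi * (cmod (h \<zeta>) powr p * d powr s)) \<le>
          ennreal (9 * C / pi * (cmod (h \<zeta>) powr p * (1 - (cmod \<zeta>)\<^sup>2) powr s))"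
        using C d dle s by (intro ennreal_leI mult_left_mono powr_mono2) auto
      also have "\<dots> = ennreal (9 * C / pi) * ennreal (cmod (h \<zeta>) powr p * (1 - (cmod \<zeta>)\<^sup>2) powr s)"
        using C by (intro ennreal_mult) auto
      finally show ?thesis using True by simp
    qed (simp add: H_def)
    finally show "(\<integral>\<^sup>+z. H \<zeta> * K \<zeta> z * u z \<partial>lborel) \<le> ennreal (9 * C / pi) *
      (ennreal (cmod (h \<zeta>) powr p * (1 - (cmod \<zeta>)\<^sup>2) powr s) * indicator unit_disc \<zeta>)" .
  qed
  also have "\<dots> = ennreal (9 * C / pi) *
      (\<integral>\<^sup>+z\<in>unit_disc. ennreal (cmod (h z) powr p * (1 - (cmod z)\<^sup>2) powr s) \<partial>lborel)"
    using conth
    by (intro nn_integral_cmult measurable_lborel2[THEN equalityD2, THEN subsetD]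
        borel_measurable_ennreal_indicator_open continuous_on_mult continuous_on_disc_weight) auto
  finally show ?thesis .
qed

text \<open>A value in \<open>ennreal\<close> permits estimates before integrability is known; for
  holomorphic functions finiteness then means membership in \<open>D_space\<close>.\<close>

definition D_energy :: "real \<Rightarrow> real \<Rightarrow> (complex \<Rightarrow> complex) \<Rightarrow> ennreal"
  where "D_energy p s f = (\<integral>\<^sup>+z\<in>unit_disc. ennreal (D_density p s f z) \<partial>lborel)"

lemma D_energy_finite_iff:
  assumes f: "f holomorphic_on unit_disc" and p: "0 < p"
  shows "f \<in> D_space p s \<longleftrightarrow> D_energy p s f < \<infinity>"
proof -
  have "(\<lambda>z. indicator unit_disc z *\<^sub>R D_density p s f z) \<in> borel_measurable borel"
    using continuous_on_D_density[OF f p] by (intro borel_measurable_continuous_on_indicator) auto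
  then have "set_integrable lborel unit_disc (D_density p s f) \<longleftrightarrow>
      (\<integral>\<^sup>+z. ennreal (norm (indicator unit_disc z *\<^sub>R D_density p s f z)) \<partial>lborel) < \<infinity>"
    unfolding set_integrable_def integrable_iff_bounded by simp
  also have "(\<integral>\<^sup>+z. ennreal (norm (indicator unit_disc z *\<^sub>R D_density p s f z)) \<partial>lborel) = D_energy p s f"
    unfolding D_energy_def by (intro nn_integral_cong) (auto simp: indicator_def D_density_nonneg)
  finally show ?thesis using f by (simp add: D_space_def)
qed

lemma ennreal_LINT_D_density:
  assumes "f \<in> D_space p s"
  shows "ennreal (LINT z:unit_disc|lborel. D_density p s f z) = D_energy p s f"
proof -
  have "D_energy p s f = (\<integral>\<^sup>+z. ennreal (indicator unit_disc z *\<^sub>R D_density p s f z) \<partial>lborel)"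
    unfolding D_energy_def by (intro nn_integral_cong) (auto simp: indicator_def)
  also have "\<dots> = ennreal (LINT z:unit_disc|lborel. D_density p s f z)"
    using assms unfolding set_lebesgue_integral_def
    by (intro nn_integral_eq_integral) (auto simp: D_space_def set_integrable_def D_density_nonneg)
  finally show ?thesis by simp
qed

lemma LINT_D_density_nonneg: "0 \<le> (LINT z:unit_disc|lborel. D_density p s f z)"
  unfolding set_lebesgue_integral_def by (intro integral_nonneg_AE) (simp add: D_density_nonneg)

lemma D_norm_nonneg: "0 \<le> D_norm p s f"
  by (simp add: D_norm_def)

text \<open>Functions are total, and identities such as the involution of \<open>disc_aut\<close>
  hold only on the disc; since the disc is open, they still determine derivatives there.\<close>

lemma D_energy_cong:
  assumes "\<And>z. cmod z < 1 \<Longrightarrow> f z = g z"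
  shows "D_energy p s f = D_energy p s g"
proof -
  have "deriv f z = deriv g z" if "z \<in> unit_disc" for z
  proof (rule deriv_cong_ev)
    show "\<forall>\<^sub>F x in nhds z. f x = g x"
      using that assms by (auto simp: eventually_nhds intro!: exI[of _ unit_disc])
  qed simp
  then show ?thesis
    unfolding D_energy_def by (intro nn_integral_cong) (auto simp: indicator_def D_density_def)
qed

lemma D_energy_plus_const:
  assumes f: "f holomorphic_on unit_disc"
  shows "D_energy p s (\<lambda>z. f z + c) = D_energy p s f"
proof -
  have "deriv (\<lambda>z. f z + c) z = deriv f z" if "z \<in> unit_disc" for z
    using holomorphic_derivI[OF f open_ball that] by (intro DERIV_imp_deriv) (auto intro!: derivative_eq_intros)
  then show ?thesis
    unfolding D_energy_def by (intro nn_integral_cong) (auto simp: indicator_def D_density_def)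
qed

text \<open>By the chain rule the density of g o f is |g'(f z)|^p times that of f, so the embedding
  is applied to h = g'.\<close>

lemma D_energy_compose:
  assumes f: "analytic_self_map f" and g: "g holomorphic_on unit_disc"
    and p: "1 \<le> p" and s: "0 \<le> s" and C: "0 \<le> C"
    and mass: "\<And>\<zeta>. cmod \<zeta> < 1 \<Longrightarrow>
      (\<integral>\<^sup>+z\<in>{z \<in> unit_disc. f z \<in> carleson_nbhd \<zeta>}. ennreal (D_density p s f z) \<partial>lborel)
        \<le> ennreal (C * (1 - cmod \<zeta>) powr (s + 2))"
  shows "D_energy p s (\<lambda>z. g (f z)) \<le> ennreal (9 * C / pi) * D_energy p s g"
proof -
  have "deriv (\<lambda>z. g (f z)) z = deriv g (f z) * deriv f z" if "z \<in> unit_disc" for z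
    using holomorphic_derivI[OF g open_ball, of "f z"] holomorphic_derivI[OF analytic_self_map_holomorphic[OF f] open_ball that]
      that analytic_self_map_norm[OF f, of z]
    by (intro DERIV_imp_deriv DERIV_chain2[where f = g]) auto
  then have "D_energy p s (\<lambda>z. g (f z)) =
      (\<integral>\<^sup>+z\<in>unit_disc. ennreal (cmod (deriv g (f z)) powr p * D_density p s f z) \<partial>lborel)"
    unfolding D_energy_def
    by (intro nn_integral_cong) (auto simp: indicator_def D_density_def norm_mult powr_mult mult_ac)
  also have "\<dots> \<le> ennreal (9 * C / pi) * D_energy p s g"
    using carleson_embedding[OF f holomorphic_deriv[OF g open_ball] p s C mass]
    unfolding D_energy_def D_density_def .
  finally show ?thesis .
qed

section \<open>Growth and composition in the Moebius-type spaces\<close>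

lemma ennreal_D_norm_powr:
  assumes "g \<in> D_space p s" "g 0 = 0" "0 < p"
  shows "ennreal (D_norm p s g powr p) = D_energy p s g"
  using assms LINT_D_density_nonneg[of p s g]
  by (simp add: D_norm_def powr_powr ennreal_LINT_D_density)

lemma D_norm_le_of_energy:
  assumes g: "g \<in> D_space p s" "g 0 = 0" and h: "h holomorphic_on unit_disc" "h 0 = 0"
    and p: "0 < p" and K: "0 \<le> K" and le: "D_energy p s h \<le> ennreal K * D_energy p s g"
  shows "h \<in> D_space p s" "D_norm p s h \<le> K powr (1 / p) * D_norm p s g"
proof -
  have "D_energy p s g < \<infinity>"
    using ennreal_LINT_D_density[OF g(1)] by (metis ennreal_less_top infinity_ennreal_def)
  then have "D_energy p s h < \<infinity>"
    using le by (metis ennreal_less_top ennreal_mult_less_top infinity_ennreal_def le_less_trans)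
  then show hD: "h \<in> D_space p s" using D_energy_finite_iff[OF h(1) p] by simp
  have "ennreal (D_norm p s h powr p) \<le> ennreal (K * D_norm p s g powr p)"
    using le K ennreal_D_norm_powr[OF hD h(2) p] ennreal_D_norm_powr[OF g p]
    by (simp add: ennreal_mult)
  then have "D_norm p s h powr p \<le> K * D_norm p s g powr p"
    using K by (simp add: ennreal_le_iff)
  then have "(D_norm p s h powr p) powr (1 / p) \<le> (K * D_norm p s g powr p) powr (1 / p)"
    using p by (intro powr_mono2) auto
  then show "D_norm p s h \<le> K powr (1 / p) * D_norm p s g"
    using p K by (simp add: powr_mult powr_powr D_norm_nonneg)
qed

text \<open>The mean value inequality for |g'|^p against the full weight. The constant bounds the
  total mass of the weight from below: on |z| < 1/2 the weight is at least (3/4)^s, and this disc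
  has area pi/4.\<close>

lemma deriv_0_le_D_norm:
  assumes g: "g \<in> D_space p s" "g 0 = 0" and p: "1 \<le> p" and s: "0 \<le> s"
  shows "cmod (deriv g 0) \<le> (1 / ((3 / 4) powr s * (pi / 4))) powr (1 / p) * D_norm p s g"
proof -
  define c where "c = (3 / 4 :: real) powr s * (pi / 4)"
  have c: "c > 0" by (simp add: c_def)
  have hol: "g holomorphic_on unit_disc" using g by (simp add: D_space_def)
  have sq: "(cmod z)\<^sup>2 \<le> 1 / 4" if "cmod z < 1 / 2" for z
    using power_mono[of "cmod z" "1 / 2" 2] that by (simp add: power2_eq_square)
  have "ennreal c = (\<integral>\<^sup>+z\<in>ball (0::complex) (1 / 2). ennreal ((3 / 4) powr s) \<partial>lborel)"
    by (simp add: nn_integral_cmult_indicator emeasure_ball unit_ball_vol_2 c_def power2_eq_square flip: ennreal_mult')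
  also have "\<dots> \<le> (\<integral>\<^sup>+z\<in>unit_disc. ennreal ((1 - (cmod z)\<^sup>2) powr s) \<partial>lborel)"
  proof (intro nn_integral_mono)
    fix z :: complex
    show "ennreal ((3 / 4) powr s) * indicator (ball 0 (1 / 2)) z \<le> ennreal ((1 - (cmod z)\<^sup>2) powr s) * indicator unit_disc z"
    proof (cases "z \<in> ball 0 (1 / 2)")
      case True
      then have "(3 / 4) powr s \<le> (1 - (cmod z)\<^sup>2) powr s"
        using sq[of z] s by (intro powr_mono2) auto
      then show ?thesis using True by (simp add: ennreal_leI)
    qed simp
  qed
  finally have c_le: "ennreal c \<le> (\<integral>\<^sup>+z\<in>unit_disc. ennreal ((1 - (cmod z)\<^sup>2) powr s) \<partial>lborel)" .
  have "ennreal (cmod (deriv g 0) powr p) * ennreal c \<le>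
      ennreal (cmod (deriv g 0) powr p) * (\<integral>\<^sup>+z\<in>unit_disc. ennreal ((1 - (cmod z)\<^sup>2) powr s) \<partial>lborel)"
    by (intro mult_left_mono c_le) simp
  also have "\<dots> \<le> (\<integral>\<^sup>+z\<in>unit_disc. ennreal (cmod (deriv g z) powr p) * ennreal ((1 - (cmod z)\<^sup>2) powr s) \<partial>lborel)"
    by (rule powr_radial_mean[OF holomorphic_deriv[OF hol open_ball] p]) (auto simp: norm_mult)
  also have "\<dots> = D_energy p s g"
    unfolding D_energy_def by (simp add: D_density_def ennreal_mult)
  also have "\<dots> = ennreal (D_norm p s g powr p)"
    using ennreal_D_norm_powr[OF g] p by simp
  finally have "ennreal (cmod (deriv g 0) powr p * c) \<le> ennreal (D_norm p s g powr p)"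
    using c by (simp add: ennreal_mult')
  then have "cmod (deriv g 0) powr p * c \<le> D_norm p s g powr p" by (simp add: ennreal_le_iff)
  then have "cmod (deriv g 0) powr p \<le> 1 / c * D_norm p s g powr p"
    using c by (simp add: field_simps)
  then have "(cmod (deriv g 0) powr p) powr (1 / p) \<le> (1 / c * D_norm p s g powr p) powr (1 / p)"
    using p by (intro powr_mono2) auto
  also have "\<dots> = (1 / c) powr (1 / p) * (D_norm p s g powr p) powr (1 / p)"
    by (rule powr_mult)
  finally show ?thesis
    using p by (simp add: powr_powr D_norm_nonneg c_def)
qed

section \<open>Pointwise growth of functions in \<open>M_space\<close>\<close>

lemma M_spaceD:
  assumes f: "f \<in> M_space \<alpha> p s"
  shows "f holomorphic_on unit_disc"
    and "\<And>a. cmod a < 1 \<Longrightarrow> disc_shift a f \<in> D_space p s"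
    and "\<And>a. cmod a < 1 \<Longrightarrow> M_term \<alpha> p s f a \<le> M_rho \<alpha> p s f"
    and "0 \<le> M_rho \<alpha> p s f"
proof -
  show "f holomorphic_on unit_disc" using f by (simp add: M_space_def D_space_def)
  show "disc_shift a f \<in> D_space p s" if "cmod a < 1" for a
    using f that by (auto simp: M_space_def)
  have le: "M_term \<alpha> p s f a \<le> M_rho \<alpha> p s f" if "cmod a < 1" for a
    unfolding M_rho_def using f that by (intro cSUP_upper) (auto simp: M_space_def)
  then show "\<And>a. cmod a < 1 \<Longrightarrow> M_term \<alpha> p s f a \<le> M_rho \<alpha> p s f" .
  have "0 \<le> M_term \<alpha> p s f 0" by (simp add: M_term_def D_norm_nonneg)
  also have "\<dots> \<le> M_rho \<alpha> p s f" by (rule le) simp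
  finally show "0 \<le> M_rho \<alpha> p s f" .
qed

lemma disc_shift_0 [simp]: "disc_shift a f 0 = 0"
  by (simp add: disc_shift_def)

text \<open>The derivative of \<open>disc_shift b f\<close> at 0 is -(1 - |b|^2) f'(b), so the
  estimate at the origin becomes one at b.\<close>

lemma M_space_deriv_bound:
  assumes f: "f \<in> M_space \<alpha> p s" and p: "1 \<le> p" and s: "0 \<le> s" and \<alpha>: "0 \<le> \<alpha>" and b: "cmod b < 1"
  shows "cmod (deriv f b) \<le>
    (1 / ((3 / 4) powr s * (pi / 4))) powr (1 / p) * M_rho \<alpha> p s f * (1 - cmod b) powr (- 1 - \<alpha>)"
proof -
  define \<kappa> where "\<kappa> = (1 / ((3 / 4) powr s * (pi / 4))) powr (1 / p)"
  define r where "r = 1 - (cmod b)\<^sup>2"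
  have r: "r > 0" using norm_square_less_one[OF b] by (simp add: r_def)
  have "(f has_field_derivative deriv f b) (at (disc_aut b 0))"
    using holomorphic_derivI[OF M_spaceD(1)[OF f] open_ball, of b] b by simp
  then have "((\<lambda>z. f (disc_aut b z)) has_field_derivative deriv f b * - of_real r) (at 0)"
    unfolding r_def using DERIV_chain2[OF _ has_field_derivative_disc_aut_0] by blast
  then have "(disc_shift b f has_field_derivative deriv f b * - of_real r) (at 0)"
    unfolding disc_shift_def by (auto intro!: derivative_eq_intros)
  then have "deriv (disc_shift b f) 0 = deriv f b * - of_real r" by (rule DERIV_imp_deriv)
  then have "cmod (deriv f b) * r = cmod (deriv (disc_shift b f) 0)"
    using r by (simp add: norm_mult)
  also have "\<dots> \<le> \<kappa> * D_norm p s (disc_shift b f)"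
    unfolding \<kappa>_def by (rule deriv_0_le_D_norm[OF M_spaceD(2)[OF f b] _ p s]) simp
  finally have "(cmod (deriv f b) * r) * r powr \<alpha> \<le> (\<kappa> * D_norm p s (disc_shift b f)) * r powr \<alpha>"
    by (intro mult_right_mono) auto
  also have "\<dots> = \<kappa> * M_term \<alpha> p s f b" by (simp add: M_term_def r_def)
  also have "\<dots> \<le> \<kappa> * M_rho \<alpha> p s f"
    using M_spaceD(3)[OF f b] by (intro mult_left_mono) (auto simp: \<kappa>_def)
  finally have *: "cmod (deriv f b) * (r * r powr \<alpha>) \<le> \<kappa> * M_rho \<alpha> p s f" by (simp add: mult_ac)
  \<comment> \<open>Replacing 1 - |b|^2 by 1 - |b| gives a bound with an explicit antiderivative
    along a radius.\<close>
  have "1 - cmod b \<le> r" using b by (simp add: r_def power2_eq_square mult_left_le)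
  then have "(1 - cmod b) powr (1 + \<alpha>) \<le> r powr (1 + \<alpha>)" using b \<alpha> by (intro powr_mono2) auto
  then have "cmod (deriv f b) * (1 - cmod b) powr (1 + \<alpha>) \<le> cmod (deriv f b) * (r * r powr \<alpha>)"
    using r by (intro mult_left_mono) (auto simp: powr_add)
  with * have "cmod (deriv f b) * (1 - cmod b) powr (1 + \<alpha>) \<le> \<kappa> * M_rho \<alpha> p s f" by linarith
  then have "cmod (deriv f b) \<le> \<kappa> * M_rho \<alpha> p s f / (1 - cmod b) powr (1 + \<alpha>)"
    using b by (simp add: pos_le_divide_eq)
  also have "\<dots> = \<kappa> * M_rho \<alpha> p s f * (1 - cmod b) powr (- 1 - \<alpha>)"
    using powr_minus_divide[of "1 - cmod b" "1 + \<alpha>"] by simp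
  finally show ?thesis by (simp add: \<kappa>_def)
qed

text \<open>The antiderivative \<Phi> is left open so that the logarithmic case and the power case
  share one argument.\<close>

lemma M_space_growth:
  assumes f: "f \<in> M_space \<alpha> p s" and p: "1 \<le> p" and s: "0 \<le> s" and \<alpha>: "0 \<le> \<alpha>" and c: "cmod c < 1"
    and \<Phi>: "\<And>r. 0 \<le> r \<Longrightarrow> r < 1 \<Longrightarrow> (\<Phi> has_real_derivative (1 - r) powr (- 1 - \<alpha>)) (at r)"
  shows "cmod (f c - f 0) \<le>
    (1 / ((3 / 4) powr s * (pi / 4))) powr (1 / p) * M_rho \<alpha> p s f * (\<Phi> (cmod c) - \<Phi> 0)"
proof -
  define B where "B = (1 / ((3 / 4) powr s * (pi / 4))) powr (1 / p) * M_rho \<alpha> p s f"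
  have small: "cmod (of_real t * c) < 1" "t * cmod c < 1" "0 \<le> t * cmod c" if "0 \<le> t" "t \<le> 1" for t
  proof -
    have "t * cmod c \<le> 1 * cmod c" using that by (intro mult_right_mono) auto
    then show "t * cmod c < 1" using c by simp
    then show "cmod (of_real t * c) < 1" using that by (simp add: norm_mult)
  qed (use that in auto)
  have Df: "((\<lambda>t. f (of_real t * c)) has_vector_derivative c * deriv f (of_real t * c)) (at t)"
    if "0 \<le> t" "t \<le> 1" for t
  proof -
    have "(f has_field_derivative deriv f (of_real t * c)) (at (of_real t * c))"
      using holomorphic_derivI[OF M_spaceD(1)[OF f] open_ball] small(1)[OF that] by simp
    moreover have "((\<lambda>t. of_real t * c) has_vector_derivative c) (at t)"
      by (auto intro!: derivative_eq_intros)
    ultimately show ?thesis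
      using field_vector_diff_chain_at[of "\<lambda>t. of_real t * c" c t f] by (simp add: o_def)
  qed
  have D\<Phi>: "((\<lambda>t. B * \<Phi> (t * cmod c)) has_vector_derivative
      B * ((1 - t * cmod c) powr (- 1 - \<alpha>) * cmod c)) (at t)" if "0 \<le> t" "t \<le> 1" for t
    unfolding has_real_derivative_iff_has_vector_derivative[symmetric]
    by (intro DERIV_cmult DERIV_chain2[where f = \<Phi>] \<Phi> small that)
       (auto intro!: derivative_eq_intros)
  \<comment> \<open>The curve t -> f (t c) is compared with a real majorant whose derivative
    dominates its speed; f' itself is never integrated.\<close>
  have "norm (f (of_real 1 * c) - f (of_real 0 * c)) \<le> B * \<Phi> (1 * cmod c) - B * \<Phi> (0 * cmod c)"
  proof (rule differentiable_bound_general[OF zero_less_one])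
    show "continuous_on {0..1} (\<lambda>t. f (of_real t * c))"
      by (intro continuous_at_imp_continuous_on ballI)
         (auto intro!: has_vector_derivative_continuous[OF Df])
    show "continuous_on {0..1} (\<lambda>t. B * \<Phi> (t * cmod c))"
      by (intro continuous_at_imp_continuous_on ballI)
         (auto intro!: has_vector_derivative_continuous[OF D\<Phi>])
    fix t :: real assume t: "0 < t" "t < 1"
    show "((\<lambda>t. f (of_real t * c)) has_vector_derivative c * deriv f (of_real t * c)) (at t)"
      using Df t by simp
    show "((\<lambda>t. B * \<Phi> (t * cmod c)) has_vector_derivative
      B * ((1 - t * cmod c) powr (- 1 - \<alpha>) * cmod c)) (at t)"
      using D\<Phi> t by simp
    have "cmod (deriv f (of_real t * c)) \<le> B * (1 - t * cmod c) powr (- 1 - \<alpha>)"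
      using M_space_deriv_bound[OF f p s \<alpha> small(1)[of t]] t by (simp add: B_def norm_mult)
    then have "cmod c * cmod (deriv f (of_real t * c)) \<le> cmod c * (B * (1 - t * cmod c) powr (- 1 - \<alpha>))"
      by (intro mult_left_mono) auto
    then show "norm (c * deriv f (of_real t * c)) \<le> B * ((1 - t * cmod c) powr (- 1 - \<alpha>) * cmod c)"
      by (simp add: norm_mult mult_ac)
  qed
  then show ?thesis by (simp add: B_def right_diff_distrib)
qed

text \<open>The claimed norm estimate without its constant, both cases in one. The e inside the
  logarithm keeps the value at least 1, so that constant terms can be absorbed.\<close>

definition op_bound :: "real \<Rightarrow> real \<Rightarrow> real"
  where "op_bound \<alpha> r = (if \<alpha> = 0 then ln (exp 1 / (1 - r)) else (1 / (1 - r)) powr \<alpha>)"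

lemma op_bound_ge_1:
  assumes "0 \<le> \<alpha>" "0 \<le> r" "r < 1"
  shows "1 \<le> op_bound \<alpha> r"
proof (cases "\<alpha> = 0")
  case True
  have "ln (exp 1 / (1 - r)) = 1 - ln (1 - r)" using assms by (simp add: ln_div)
  moreover have "ln (1 - r) \<le> 0" using assms by simp
  ultimately show ?thesis using True by (simp add: op_bound_def)
next
  case False
  have "1 \<le> 1 / (1 - r)" using assms by simp
  then have "1 \<le> (1 / (1 - r)) powr \<alpha>" using assms by (intro ge_one_powr_ge_zero) auto
  then show ?thesis using False by (simp add: op_bound_def)
qed

text \<open>The antiderivatives are -ln (1 - r) at \<alpha> = 0 and (1 - r)^(-\<alpha>) / \<alpha>
  otherwise; the latter is the origin of 1 / \<alpha>.\<close>

lemma M_space_growth_op_bound: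
  assumes f: "f \<in> M_space \<alpha> p s" and p: "1 \<le> p" and s: "0 \<le> s" and \<alpha>: "0 \<le> \<alpha>" and c: "cmod c < 1"
  shows "cmod (f c - f 0) \<le>
    (1 / ((3 / 4) powr s * (pi / 4))) powr (1 / p) * (if \<alpha> = 0 then 1 else 1 / \<alpha>) *
      M_rho \<alpha> p s f * op_bound \<alpha> (cmod c)"
proof -
  define \<kappa> where "\<kappa> = (1 / ((3 / 4 :: real) powr s * (pi / 4))) powr (1 / p)"
  have B: "0 \<le> \<kappa> * M_rho \<alpha> p s f" using M_spaceD(4)[OF f] by (simp add: \<kappa>_def)
  show ?thesis
  proof (cases "\<alpha> = 0")
    case True
    have "((\<lambda>r. - ln (1 - r)) has_real_derivative (1 - r) powr (- 1 - \<alpha>)) (at r)" if "0 \<le> r" "r < 1" for r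
      using that True by (auto intro!: derivative_eq_intros simp: powr_minus_divide)
    from M_space_growth[OF f p s \<alpha> c this]
    have "cmod (f c - f 0) \<le> \<kappa> * M_rho \<alpha> p s f * (- ln (1 - cmod c))" by (simp add: \<kappa>_def)
    also have "\<dots> \<le> \<kappa> * M_rho \<alpha> p s f * op_bound \<alpha> (cmod c)"
      using B c True by (intro mult_left_mono) (auto simp: op_bound_def ln_div)
    finally show ?thesis using True by (simp add: \<kappa>_def)
  next
    case False
    have "((\<lambda>r. (1 - r) powr (- \<alpha>) / \<alpha>) has_real_derivative (1 - r) powr (- 1 - \<alpha>)) (at r)"
      if "0 \<le> r" "r < 1" for r
      using that False by (auto intro!: derivative_eq_intros simp: minus_diff_commute)
    from M_space_growth[OF f p s \<alpha> c this]
    have "cmod (f c - f 0) \<le> \<kappa> * M_rho \<alpha> p s f * ((1 - cmod c) powr (- \<alpha>) / \<alpha> - 1 / \<alpha>)"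
      by (simp add: \<kappa>_def)
    also have "\<dots> \<le> \<kappa> * M_rho \<alpha> p s f * ((1 - cmod c) powr (- \<alpha>) / \<alpha>)"
      using B \<alpha> by (intro mult_left_mono) auto
    also have "(1 - cmod c) powr (- \<alpha>) = op_bound \<alpha> (cmod c)"
      using False c by (simp add: op_bound_def powr_divide powr_minus_divide)
    finally show ?thesis using False by (simp add: \<kappa>_def mult_ac)
  qed
qed

section \<open>Conjugation to a map that fixes the origin\<close>

lemma univalent_compose:
  assumes "univalent f" "univalent g" "g ` unit_disc \<subseteq> unit_disc"
  shows "univalent (\<lambda>z. f (g z))"
  using assms comp_inj_on[of g unit_disc f] holomorphic_on_compose_gen[of g unit_disc f unit_disc]
  by (auto simp: univalent_def o_def intro: inj_on_subset)

lemma univalent_disc_aut: "cmod a < 1 \<Longrightarrow> univalent (disc_aut a)"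
  by (simp add: univalent_def holomorphic_on_disc_aut inj_on_disc_aut)

text \<open>
  The maps \<open>disc_aut (\<phi> a) \<circ> \<phi> \<circ> disc_aut a\<close> fix the origin, so that a norm bound for
  composition with such maps controls every term of the supremum.
\<close>

lemma comp_op_shift:
  assumes f: "f \<in> M_space \<alpha> p s" and \<phi>: "analytic_self_map \<phi>" and p: "1 \<le> p" and s: "0 \<le> s"
    and C: "0 \<le> C"
    and mass: "\<And>\<psi> \<zeta>. analytic_self_map \<psi> \<Longrightarrow> \<psi> 0 = 0 \<Longrightarrow> (univalent \<phi> \<Longrightarrow> univalent \<psi>) \<Longrightarrow> cmod \<zeta> < 1 \<Longrightarrow>
      (\<integral>\<^sup>+z\<in>{z \<in> unit_disc. \<psi> z \<in> carleson_nbhd \<zeta>}. ennreal (D_density p s \<psi> z) \<partial>lborel)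
        \<le> ennreal (C * (1 - cmod \<zeta>) powr (s + 2))"
    and \<tau>: "analytic_self_map \<tau>" "univalent \<tau>" "\<tau> 0 = a"
    and g: "\<And>z. g z = f (\<phi> (\<tau> z)) - f (\<phi> a)"
  shows "g \<in> D_space p s"
    and "D_norm p s g \<le> (9 * C / pi) powr (1 / p) * D_norm p s (disc_shift (\<phi> a) f)"
proof -
  have a: "cmod a < 1" using analytic_self_map_norm[OF \<tau>(1), of 0] \<tau>(3) by simp
  define b where "b = \<phi> a"
  have b: "cmod b < 1" unfolding b_def by (rule analytic_self_map_norm[OF \<phi> a])
  define \<psi> where "\<psi> z = disc_aut b (\<phi> (\<tau> z))" for z
  have \<phi>\<tau>: "analytic_self_map (\<lambda>z. \<phi> (\<tau> z))" by (rule analytic_self_map_compose[OF \<phi> \<tau>(1)])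
  have \<psi>: "analytic_self_map \<psi>"
    unfolding \<psi>_def by (rule analytic_self_map_compose[OF analytic_self_map_disc_aut[OF b] \<phi>\<tau>])
  have \<psi>0: "\<psi> 0 = 0" by (simp add: \<psi>_def \<tau>(3) b_def)
  have uni: "univalent \<psi>" if "univalent \<phi>"
    unfolding \<psi>_def
    using univalent_compose[OF univalent_disc_aut[OF b] univalent_compose[OF that \<tau>(2)]] \<phi>\<tau> \<tau>(1)
    by (auto simp: analytic_self_map_def)
  \<comment> \<open>\<open>disc_aut b\<close> undoes itself on the disc, so the shift at b evaluated
    along \<psi> recovers f o \<phi> o \<tau> up to the constant.\<close>
  have eq: "disc_shift b f (\<psi> z) = g z" if "cmod z < 1" for z
    using disc_aut_involution[OF b analytic_self_map_norm[OF \<phi>\<tau> that]]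
    by (simp add: disc_shift_def \<psi>_def g b_def)
  have sh: "disc_shift b f \<in> D_space p s" by (rule M_spaceD(2)[OF f b])
  then have hol: "disc_shift b f holomorphic_on unit_disc" by (simp add: D_space_def)
  have "f holomorphic_on unit_disc" by (rule M_spaceD(1)[OF f])
  then have "(\<lambda>z. f (\<phi> (\<tau> z))) holomorphic_on unit_disc"
    using \<phi>\<tau> holomorphic_on_compose_gen[of "\<lambda>z. \<phi> (\<tau> z)" unit_disc f unit_disc]
    by (auto simp: analytic_self_map_def o_def)
  then have holg: "g holomorphic_on unit_disc"
    unfolding g[abs_def] by (intro holomorphic_intros)
  have g0: "g 0 = 0" by (simp add: g \<tau>(3))
  have "D_energy p s g = D_energy p s (\<lambda>z. disc_shift b f (\<psi> z))"
    by (rule D_energy_cong) (simp add: eq)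
  also have "\<dots> \<le> ennreal (9 * C / pi) * D_energy p s (disc_shift b f)"
    by (rule D_energy_compose[OF \<psi> hol p s C mass[OF \<psi> \<psi>0 uni]])
  finally show "g \<in> D_space p s"
    and "D_norm p s g \<le> (9 * C / pi) powr (1 / p) * D_norm p s (disc_shift (\<phi> a) f)"
    using D_norm_le_of_energy[OF sh _ holg g0, of "9 * C / pi"] C p by (auto simp: b_def)
qed

lemma comp_op_M_bound:
  assumes f: "f \<in> M_space \<alpha> p s" and \<phi>: "analytic_self_map \<phi>" and p: "1 \<le> p" and s: "0 \<le> s"
    and \<alpha>: "0 \<le> \<alpha>" and C: "0 \<le> C"
    and mass: "\<And>\<psi> \<zeta>. analytic_self_map \<psi> \<Longrightarrow> \<psi> 0 = 0 \<Longrightarrow> (univalent \<phi> \<Longrightarrow> univalent \<psi>) \<Longrightarrow> cmod \<zeta> < 1 \<Longrightarrow>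
      (\<integral>\<^sup>+z\<in>{z \<in> unit_disc. \<psi> z \<in> carleson_nbhd \<zeta>}. ennreal (D_density p s \<psi> z) \<partial>lborel)
        \<le> ennreal (C * (1 - cmod \<zeta>) powr (s + 2))"
  shows "comp_op \<phi> f \<in> M_space \<alpha> p s"
    and "M_norm \<alpha> p s (comp_op \<phi> f) \<le>
      (1 + (1 / ((3 / 4) powr s * (pi / 4))) powr (1 / p) * (if \<alpha> = 0 then 1 else 1 / \<alpha>)
        + 2 powr \<alpha> * (9 * C / pi) powr (1 / p)) * op_bound \<alpha> (cmod (\<phi> 0)) * M_norm \<alpha> p s f"
proof -
  define r where "r = cmod (\<phi> 0)"
  have r: "0 \<le> r" "r < 1" using analytic_self_map_norm[OF \<phi>, of 0] by (auto simp: r_def)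
  define L where "L = op_bound \<alpha> r"
  have L: "1 \<le> L" unfolding L_def by (rule op_bound_ge_1[OF \<alpha> r])
  define \<rho> where "\<rho> = M_rho \<alpha> p s f"
  have \<rho>: "0 \<le> \<rho>" unfolding \<rho>_def by (rule M_spaceD(4)[OF f])
  define k where "k = (9 * C / pi) powr (1 / p)"
  define \<kappa> where "\<kappa> = (1 / ((3 / 4 :: real) powr s * (pi / 4))) powr (1 / p) * (if \<alpha> = 0 then 1 else 1 / \<alpha>)"
  have \<kappa>: "0 \<le> \<kappa>" using \<alpha> by (auto simp: \<kappa>_def)
  have shift: "disc_shift a (comp_op \<phi> f) \<in> D_space p s"
    "D_norm p s (disc_shift a (comp_op \<phi> f)) \<le> k * D_norm p s (disc_shift (\<phi> a) f)" if "cmod a < 1" for a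
  proof -
    have "disc_shift a (comp_op \<phi> f) z = f (\<phi> (disc_aut a z)) - f (\<phi> a)" for z
      by (simp add: disc_shift_def comp_op_def)
    note comp_op_shift[OF f \<phi> p s C mass analytic_self_map_disc_aut[OF that] univalent_disc_aut[OF that] disc_aut_0 this]
    then show "disc_shift a (comp_op \<phi> f) \<in> D_space p s"
      "D_norm p s (disc_shift a (comp_op \<phi> f)) \<le> k * D_norm p s (disc_shift (\<phi> a) f)"
      by (auto simp: k_def)
  qed
  \<comment> \<open>Membership of f o \<phi> itself is the case where \<tau> is the identity;
    \<open>disc_aut 0\<close> would not do, being z -> -z.\<close>
  have "(\<lambda>z. f (\<phi> z) - f (\<phi> 0)) \<in> D_space p s"
    by (rule comp_op_shift(1)[OF f \<phi> p s C mass, of "\<lambda>z. z" 0])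
       (auto simp: analytic_self_map_def univalent_def intro!: holomorphic_intros)
  then have "D_energy p s (\<lambda>z. f (\<phi> z) - f (\<phi> 0)) < \<infinity>" and hol0: "(\<lambda>z. f (\<phi> z) - f (\<phi> 0)) holomorphic_on unit_disc"
    using D_energy_finite_iff p by (auto simp: D_space_def)
  then have "D_energy p s (\<lambda>z. (f (\<phi> z) - f (\<phi> 0)) + f (\<phi> 0)) < \<infinity>"
    by (subst D_energy_plus_const)
  moreover have "comp_op \<phi> f = (\<lambda>z. (f (\<phi> z) - f (\<phi> 0)) + f (\<phi> 0))"
    by (auto simp: comp_op_def)
  moreover have "(\<lambda>z. (f (\<phi> z) - f (\<phi> 0)) + f (\<phi> 0)) holomorphic_on unit_disc"
    using hol0 by (intro holomorphic_on_add holomorphic_on_const)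
  ultimately have inD: "comp_op \<phi> f \<in> D_space p s"
    using D_energy_finite_iff[of "comp_op \<phi> f" p s] p by simp
  have term_le: "M_term \<alpha> p s (comp_op \<phi> f) a \<le> 2 powr \<alpha> * k * L * \<rho>" if "cmod a < 1" for a
  proof -
    have b: "cmod (\<phi> a) < 1" by (rule analytic_self_map_norm[OF \<phi> that])
    have pos: "0 < 1 - (cmod a)\<^sup>2" "0 < 1 - (cmod (\<phi> a))\<^sup>2"
      using norm_square_less_one[OF that] norm_square_less_one[OF b] by auto
    have "(1 - (cmod a)\<^sup>2) powr \<alpha> \<le> (2 / (1 - r) * (1 - (cmod (\<phi> a))\<^sup>2)) powr \<alpha>"
      using Schwarz_Pick_boundary[OF \<phi> that] pos \<alpha> unfolding r_def by (intro powr_mono2) auto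
    also have "\<dots> = (2 * (1 / (1 - r))) powr \<alpha> * (1 - (cmod (\<phi> a))\<^sup>2) powr \<alpha>"
      using r pos by (subst powr_mult) auto
    also have "(2 * (1 / (1 - r))) powr \<alpha> = 2 powr \<alpha> * (1 / (1 - r)) powr \<alpha>"
      by (rule powr_mult)
    \<comment> \<open>At \<alpha> = 0 the power is 1 and L is a logarithm, so
      \<open>1 \<le> L\<close> is used; otherwise the two sides agree.\<close>
    also have "\<dots> \<le> 2 powr \<alpha> * L"
      using L by (intro mult_left_mono) (auto simp: L_def op_bound_def)
    finally have w: "(1 - (cmod a)\<^sup>2) powr \<alpha> \<le> 2 powr \<alpha> * L * (1 - (cmod (\<phi> a))\<^sup>2) powr \<alpha>"
      by (simp add: mult_right_mono)
    have "M_term \<alpha> p s (comp_op \<phi> f) a \<le>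
      (2 powr \<alpha> * L * (1 - (cmod (\<phi> a))\<^sup>2) powr \<alpha>) * (k * D_norm p s (disc_shift (\<phi> a) f))"
      unfolding M_term_def using w shift(2)[OF that] L by (intro mult_mono) (auto simp: D_norm_nonneg)
    also have "\<dots> = 2 powr \<alpha> * k * L * M_term \<alpha> p s f (\<phi> a)" by (simp add: M_term_def)
    also have "\<dots> \<le> 2 powr \<alpha> * k * L * \<rho>"
      unfolding \<rho>_def using L M_spaceD(3)[OF f b] by (intro mult_left_mono) (auto simp: k_def)
    finally show ?thesis .
  qed
  then have bdd: "bdd_above (M_term \<alpha> p s (comp_op \<phi> f) ` unit_disc)"
    by (intro bdd_aboveI2[of _ _ "2 powr \<alpha> * k * L * \<rho>"]) simp
  show "comp_op \<phi> f \<in> M_space \<alpha> p s"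
    unfolding M_space_def using inD shift(1) bdd by auto
  have "M_rho \<alpha> p s (comp_op \<phi> f) \<le> 2 powr \<alpha> * k * L * \<rho>"
    unfolding M_rho_def using term_le by (intro cSUP_least) auto
  moreover have "cmod (comp_op \<phi> f 0) \<le> cmod (f 0) + \<kappa> * \<rho> * L"
  proof -
    have "cmod (f (\<phi> 0) - f 0) \<le> \<kappa> * \<rho> * L"
      using M_space_growth_op_bound[OF f p s \<alpha>, of "\<phi> 0"] r by (simp add: \<kappa>_def \<rho>_def L_def r_def)
    then show ?thesis
      using norm_triangle_sub[of "f (\<phi> 0)" "f 0"] by (simp add: comp_op_def)
  qed
  ultimately have "M_norm \<alpha> p s (comp_op \<phi> f) \<le> 1 * cmod (f 0) + (\<kappa> + 2 powr \<alpha> * k) * L * \<rho>"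
    by (simp add: M_norm_def algebra_simps)
  \<comment> \<open>The whole factor is at least 1, so |f 0|, which carries the coefficient 1, can
    be put under it together with the term in \<rho>.\<close>
  also have "\<dots> \<le> ((1 + \<kappa> + 2 powr \<alpha> * k) * L) * cmod (f 0) + ((1 + \<kappa> + 2 powr \<alpha> * k) * L) * \<rho>"
  proof (intro add_mono mult_right_mono)
    have "1 * 1 \<le> (1 + \<kappa> + 2 powr \<alpha> * k) * L"
      using \<kappa> L by (intro mult_mono) (auto simp: k_def)
    then show "1 \<le> (1 + \<kappa> + 2 powr \<alpha> * k) * L" by simp
  qed (use L \<rho> \<kappa> in \<open>auto simp: k_def\<close>)
  also have "\<dots> = (1 + \<kappa> + 2 powr \<alpha> * k) * L * M_norm \<alpha> p s f"
    by (simp add: M_norm_def \<rho>_def algebra_simps)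
  finally show "M_norm \<alpha> p s (comp_op \<phi> f) \<le>
      (1 + (1 / ((3 / 4) powr s * (pi / 4))) powr (1 / p) * (if \<alpha> = 0 then 1 else 1 / \<alpha>)
        + 2 powr \<alpha> * (9 * C / pi) powr (1 / p)) * op_bound \<alpha> (cmod (\<phi> 0)) * M_norm \<alpha> p s f"
    by (simp add: \<kappa>_def k_def L_def r_def)
qed

section \<open>Uniform constants and the operator norm\<close>

lemma comp_op_uniform_bound:
  assumes p: "1 < p" and s: "p - 2 < s" and \<alpha>: "0 \<le> \<alpha>"
  obtains C where "C > 0"
    and "\<And>\<phi> f. analytic_self_map \<phi> \<Longrightarrow> p - 1 < s \<or> univalent \<phi> \<and> admissible_univalent_params p s \<Longrightarrow>
      f \<in> M_space \<alpha> p s \<Longrightarrow> comp_op \<phi> f \<in> M_space \<alpha> p s \<and>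
      M_norm \<alpha> p s (comp_op \<phi> f) \<le> C * op_bound \<alpha> (cmod (\<phi> 0)) * M_norm \<alpha> p s f"
proof (cases "p - 1 < s \<or> admissible_univalent_params p s")
  case False
  \<comment> \<open>No map meets the condition for these parameters, so the claim is vacuous and any
    positive number serves.\<close>
  show thesis by (rule that[of 1]) (use False in auto)
next
  case True
  \<comment> \<open>The three cases give s > p - 1 > 0, s > p - 2 >= 0, or s >= 0 directly.\<close>
  then have s0: "0 \<le> s" using p by (auto simp: admissible_univalent_params_def)
  obtain C where C: "C > 0" and mass: "\<And>f \<zeta>. analytic_self_map f \<Longrightarrow> f 0 = 0 \<Longrightarrow>
      p - 1 < s \<or> univalent f \<and> admissible_univalent_params p s \<Longrightarrow> cmod \<zeta> < 1 \<Longrightarrow>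
      (\<integral>\<^sup>+z\<in>{z \<in> unit_disc. f z \<in> carleson_nbhd \<zeta>}. ennreal (D_density p s f z) \<partial>lborel)
        \<le> ennreal (C * (1 - cmod \<zeta>) powr (s + 2))"
    using preimage_mass_bound[OF p s] by blast
  have p1: "1 \<le> p" and C0: "0 \<le> C" using p C by auto
  define K where "K = 1 + (1 / ((3 / 4) powr s * (pi / 4))) powr (1 / p) * (if \<alpha> = 0 then 1 else 1 / \<alpha>)
        + 2 powr \<alpha> * (9 * C / pi) powr (1 / p)"
  have "K > 0" unfolding K_def using \<alpha> by (intro add_pos_nonneg) auto
  moreover have "comp_op \<phi> f \<in> M_space \<alpha> p s \<and>
      M_norm \<alpha> p s (comp_op \<phi> f) \<le> K * op_bound \<alpha> (cmod (\<phi> 0)) * M_norm \<alpha> p s f"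
    if "analytic_self_map \<phi>" "p - 1 < s \<or> univalent \<phi> \<and> admissible_univalent_params p s" "f \<in> M_space \<alpha> p s" for \<phi> f
    unfolding K_def
    using comp_op_M_bound[OF that(3,1) p1 s0 \<alpha> C0] mass that(2) by blast
  ultimately show thesis by (rule that)
qed

text \<open>Provides a point of the closed unit ball: bounding a supremum of reals by
  \<open>cSUP_least\<close> requires a nonempty index set.\<close>

lemma zero_in_M_space: "(\<lambda>_. 0) \<in> M_space \<alpha> p s" "M_norm \<alpha> p s (\<lambda>_. 0) = 0"
proof -
  have D: "D_density p s (\<lambda>_. 0) = (\<lambda>_. 0)" by (simp add: D_density_def fun_eq_iff)
  have sh: "disc_shift a (\<lambda>_. 0) = (\<lambda>_. 0)" for a by (simp add: disc_shift_def fun_eq_iff)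
  have N: "D_norm p s (\<lambda>_. 0) = 0" by (simp add: D_norm_def D set_lebesgue_integral_def)
  have T: "M_term \<alpha> p s (\<lambda>_. 0) = (\<lambda>_. 0)" by (simp add: M_term_def sh N fun_eq_iff)
  show "(\<lambda>_. 0) \<in> M_space \<alpha> p s"
    by (simp add: M_space_def D_space_def sh D T set_integrable_def image_constant_conv)
  show "M_norm \<alpha> p s (\<lambda>_. 0) = 0" by (simp add: M_norm_def M_rho_def T)
qed

lemma M_op_norm_le:
  assumes B: "0 \<le> B" and le: "\<And>f. f \<in> M_space \<alpha> p s \<Longrightarrow> M_norm \<alpha> p s (T f) \<le> B * M_norm \<alpha> p s f"
  shows "M_op_norm \<alpha> p s T \<le> B"
  unfolding M_op_norm_def
proof (rule cSUP_least)
  show "{f \<in> M_space \<alpha> p s. M_norm \<alpha> p s f \<le> 1} \<noteq> {}"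
    using zero_in_M_space[of \<alpha> p s] by (auto intro!: exI[of _ "\<lambda>_. 0"])
  fix f assume f: "f \<in> {f \<in> M_space \<alpha> p s. M_norm \<alpha> p s f \<le> 1}"
  then have "M_norm \<alpha> p s (T f) \<le> B * M_norm \<alpha> p s f" using le by simp
  also have "\<dots> \<le> B * 1" using f B by (intro mult_left_mono) auto
  finally show "M_norm \<alpha> p s (T f) \<le> B" by simp
qed

theorem theorem1p1:
  fixes p s \<alpha> :: real
  assumes "1 < p" and "p - 2 < s" and "0 \<le> \<alpha>" and "\<alpha> < (s - (p - 2)) / p"
  shows "(\<forall>\<phi>. analytic_self_map \<phi> \<longrightarrow> p - 1 < s \<longrightarrow> M_bounded_op \<alpha> p s (comp_op \<phi>)) \<and>
    (\<forall>\<phi>. analytic_self_map \<phi> \<longrightarrow> univalent \<phi> \<and> admissible_univalent_params p s \<longrightarrow>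
       M_bounded_op \<alpha> p s (comp_op \<phi>)) \<and>
    (\<exists>C>0. \<forall>\<phi>. analytic_self_map \<phi> \<longrightarrow> p - 1 < s \<or> univalent \<phi> \<and> admissible_univalent_params p s \<longrightarrow>
       (\<alpha> = 0 \<longrightarrow> M_op_norm \<alpha> p s (comp_op \<phi>) \<le> C * ln (exp 1 / (1 - cmod (\<phi> 0)))) \<and>
       (\<alpha> > 0 \<longrightarrow> M_op_norm \<alpha> p s (comp_op \<phi>) \<le> C * (1 / (1 - cmod (\<phi> 0))) powr \<alpha>))"
proof -
  obtain C where C: "C > 0"
    and bound: "\<And>\<phi> f. analytic_self_map \<phi> \<Longrightarrow> p - 1 < s \<or> univalent \<phi> \<and> admissible_univalent_params p s \<Longrightarrow>
      f \<in> M_space \<alpha> p s \<Longrightarrow> comp_op \<phi> f \<in> M_space \<alpha> p s \<and>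
      M_norm \<alpha> p s (comp_op \<phi> f) \<le> C * op_bound \<alpha> (cmod (\<phi> 0)) * M_norm \<alpha> p s f"
    using comp_op_uniform_bound[OF assms(1-3)] by blast
  have bdd: "M_bounded_op \<alpha> p s (comp_op \<phi>)"
    if "analytic_self_map \<phi>" "p - 1 < s \<or> univalent \<phi> \<and> admissible_univalent_params p s" for \<phi>
    unfolding M_bounded_op_def using bound[OF that] by blast
  have norm: "M_op_norm \<alpha> p s (comp_op \<phi>) \<le> C * op_bound \<alpha> (cmod (\<phi> 0))"
    if \<phi>: "analytic_self_map \<phi>" "p - 1 < s \<or> univalent \<phi> \<and> admissible_univalent_params p s" for \<phi>
  proof (rule M_op_norm_le)
    have "1 \<le> op_bound \<alpha> (cmod (\<phi> 0))"
      using op_bound_ge_1[OF assms(3)] analytic_self_map_norm[OF \<phi>(1), of 0] by simp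
    then show "0 \<le> C * op_bound \<alpha> (cmod (\<phi> 0))" using C by simp
  qed (use bound[OF \<phi>] in blast)
  show ?thesis
  proof (intro conjI allI impI exI[of _ C] C)
    fix \<phi> assume \<phi>: "analytic_self_map \<phi>" "p - 1 < s \<or> univalent \<phi> \<and> admissible_univalent_params p s"
    show "M_op_norm \<alpha> p s (comp_op \<phi>) \<le> C * ln (exp 1 / (1 - cmod (\<phi> 0)))" if "\<alpha> = 0"
      using norm[OF \<phi>] that by (simp add: op_bound_def)
    show "M_op_norm \<alpha> p s (comp_op \<phi>) \<le> C * (1 / (1 - cmod (\<phi> 0))) powr \<alpha>" if "\<alpha> > 0"
      using norm[OF \<phi>] that by (simp add: op_bound_def)
  qed (use bdd in auto)
qed

end
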